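(* Let $\varphi=(\varphi_1,\ldots,\varphi_n)$ be a free holomorphic self-map of the noncommutative ball $[B(\mathcal H)^n]_1$. Then the adjoint of the composition operator $C_\varphi$ on $H^2_{\bf ball}$ satisfies the relation $$(C_\varphi^*f)(X_1,\ldots,X_n)=\sum_{\alpha\in\mathbb F_n^+}\langle f,\varphi_\alpha\rangle X_\alpha,\qquad f\in H^2_{\bf ball}.$$
   Context: $n\ge1$; $\mathcal H$ is a separable infinite dimensional complex Hilbert space. $\mathbb F_n^+$ is the free semigroup with generators $g_1,\ldots,g_n$ and identity $g_0$; $|g_0|=0$, $|\alpha|=k$ if $\alpha=g_{i_1}\cdots g_{i_k}$; $X_\alpha:=X_{i_1}\cdots X_{i_k}$, $X_{g_0}:=I$. $[B(\mathcal H)^n]_1:=\{(X_1,\ldots,X_n)\in B(\mathcal H)^n:\ \|X_1X_1^*+\cdots+X_nX_n^*\|^{1/2}<1\}$. A free holomorphic function $f:[B(\mathcal H)^n]_1\to B(\mathcal H)$ is a map $f(X)=\sum_{k=0}^\infty\sum_{|\alpha|=k}a_\alpha X_\alpha$ (series over $k$ converging in operator norm) with $a_\alpha\in\mathbb C$ and $\limsup_{k\to\infty}(\sum_{|\alpha|=k}|a_\alpha|^2)^{1/2k}\le1$. A free holomorphic self-map $\varphi=(\varphi_1,\ldots,\varphi_n)$ of $[B(\mathcal H)^n]_1$ has each $\varphi_i$ free holomorphic and maps $[B(\mathcal H)^n]_1$ into itself. $\varphi_\alpha:=\varphi_{i_1}\cdots\varphi_{i_k}$ (pointwise product; $\varphi_{g_0}=I$),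 and $(f\circ\varphi)(X)=\sum_{k=0}^\infty\sum_{|\alpha|=k}a_\alpha\varphi_\alpha(X)$. $H^2_{\bf ball}$ is the Hilbert space of free holomorphic functions $f=\sum_\alpha a_\alpha X_\alpha$ on $[B(\mathcal H)^n]_1$ with $\sum_\alpha|a_\alpha|^2<\infty$ and inner product $\langle f,g\rangle=\sum_\alpha a_\alpha\overline{b}_\alpha$ for $g=\sum_\alpha b_\alpha X_\alpha$. The functions $\varphi_\alpha$ belong to $H^2_{\bf ball}$, and $C_\varphi f:=f\circ\varphi$ is a bounded operator on $H^2_{\bf ball}$. *)

theory Defs
  imports "HOL-Analysis.Analysis"
begin

section \<open>Complex Hilbert spaces\<close>

text \<open>The distribution has real inner product spaces only. A complex Hilbert space is a complete
  real inner product space with a compatible complex scalar multiplication and a complex inner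
  product, linear in the first argument, whose real part is the given real inner product (so that
  \<^term>\<open>norm x\<close> is the norm induced by the complex inner product).\<close>

class chilbert_space = real_inner + complete_space +
  fixes scaleC :: "complex \<Rightarrow> 'a \<Rightarrow> 'a"  (infixr \<open>*\<^sub>C\<close> 75)
    and cinner :: "'a \<Rightarrow> 'a \<Rightarrow> complex"
  assumes scaleC_add_right: "c *\<^sub>C (x + y) = c *\<^sub>C x + c *\<^sub>C y"
    and scaleC_add_left: "(c + d) *\<^sub>C x = c *\<^sub>C x + d *\<^sub>C x"
    and scaleC_scaleC: "c *\<^sub>C (d *\<^sub>C x) = (c * d) *\<^sub>C x"
    and scaleC_of_real: "complex_of_real r *\<^sub>C x = r *\<^sub>R x"
    and cinner_commute: "cinner x y = cnj (cinner y x)"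
    and cinner_add_left: "cinner (x + y) z = cinner x z + cinner y z"
    and cinner_scaleC_left: "cinner (c *\<^sub>C x) y = c * cinner x y"
    and inner_eq_Re_cinner: "inner x y = Re (cinner x y)"

lemma vector_space_scaleC: "vector_space (scaleC :: complex \<Rightarrow> 'h::chilbert_space \<Rightarrow> 'h)"
proof
  show "1 *\<^sub>C x = x" for x :: 'h
    using scaleC_of_real[of 1 x] by simp
qed (simp_all add: scaleC_add_right scaleC_add_left scaleC_scaleC)

lemma cinner_self: "cinner x x = complex_of_real ((norm x)\<^sup>2)"
proof -
  have "Im (cinner x x) = 0"
    using arg_cong[OF cinner_commute[of x x], of Im] by simp
  then show ?thesis
    by (simp add: complex_eq_iff power2_norm_eq_inner inner_eq_Re_cinner)
qed

lemma norm_scaleC: "norm (c *\<^sub>C x) = cmod c * norm (x :: 'h::chilbert_space)"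
proof -
  have "cinner (c *\<^sub>C x) (c *\<^sub>C x) = c * cnj (c * cinner x x)"
    by (metis cinner_commute cinner_scaleC_left)
  also have "\<dots> = complex_of_real ((cmod c * norm x)\<^sup>2)"
    by (simp add: cinner_self power_mult_distrib complex_norm_square mult.assoc del: of_real_power)
  finally have "(norm (c *\<^sub>C x))\<^sup>2 = (cmod c * norm x)\<^sup>2"
    unfolding cinner_self of_real_eq_iff .
  then show ?thesis
    by (simp add: power2_eq_iff_nonneg)
qed

section \<open>Bounded operators on a complex Hilbert space\<close>

text \<open>The library type \<^typ>\<open>'h \<Rightarrow>\<^sub>L 'h\<close> consists of the bounded real-linear operators, with the
  operator norm; \<open>BH\<close> is the algebra of the complex-linear ones among them.\<close>

definition BH :: "('h::chilbert_space \<Rightarrow>\<^sub>L 'h) set" where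
  "BH = {T. \<forall>c x. blinfun_apply T (c *\<^sub>C x) = c *\<^sub>C blinfun_apply T x}"

lift_definition scale_op :: "complex \<Rightarrow> ('h::chilbert_space \<Rightarrow>\<^sub>L 'h) \<Rightarrow> ('h \<Rightarrow>\<^sub>L 'h)"
  is "\<lambda>c T x. c *\<^sub>C T x"
proof -
  fix c :: complex and T :: "'h \<Rightarrow> 'h"
  assume T: "bounded_linear T"
  then interpret T: bounded_linear T .
  obtain K where K: "\<And>x. norm (T x) \<le> norm x * K"
    using T.bounded by blast
  show "bounded_linear (\<lambda>x. c *\<^sub>C T x)"
  proof (rule bounded_linear_intro[where K = "cmod c * K"])
    show "c *\<^sub>C T (x + y) = c *\<^sub>C T x + c *\<^sub>C T y" for x y
      by (simp add: T.add scaleC_add_right)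
    show "c *\<^sub>C T (r *\<^sub>R x) = r *\<^sub>R (c *\<^sub>C T x)" for r x
      by (simp only: T.scaleR) (simp add: scaleC_of_real[symmetric] scaleC_scaleC mult.commute)
    show "norm (c *\<^sub>C T x) \<le> norm x * (cmod c * K)" for x
      using mult_left_mono[OF K[of x], of "cmod c"] by (simp add: norm_scaleC mult_ac)
  qed
qed

definition op_adj :: "('h::chilbert_space \<Rightarrow>\<^sub>L 'h) \<Rightarrow> ('h \<Rightarrow>\<^sub>L 'h)" where
  "op_adj T = (THE S. S \<in> BH \<and> (\<forall>x y. cinner (blinfun_apply T x) y = cinner x (blinfun_apply S y)))"

section \<open>Free holomorphic functions on the noncommutative ball\<close>

text \<open>The number \<open>n\<close> of variables is \<^term>\<open>CARD('n)\<close>, and the free semigroup on \<open>n\<close> generators is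
  \<^typ>\<open>'n list\<close>, with \<^term>\<open>length \<alpha>\<close> as length and \<^term>\<open>[]\<close> as identity.\<close>

definition nc_ball :: "('n::finite \<Rightarrow> ('h::chilbert_space \<Rightarrow>\<^sub>L 'h)) set" where
  "nc_ball = {X. (\<forall>i. X i \<in> BH) \<and> sqrt (norm (\<Sum>i\<in>UNIV. X i o\<^sub>L op_adj (X i))) < 1}"

primrec word_op :: "('n \<Rightarrow> ('h::chilbert_space \<Rightarrow>\<^sub>L 'h)) \<Rightarrow> 'n list \<Rightarrow> ('h \<Rightarrow>\<^sub>L 'h)" where
  "word_op X [] = id_blinfun"
| "word_op X (i # \<alpha>) = X i o\<^sub>L word_op X \<alpha>"

text \<open>Functions on the ball are represented by total functions that are \<^term>\<open>undefined\<close> outside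
  it, so that equality of such functions means equality on the ball.\<close>

type_synonym ('n, 'h) ncfun = "('n \<Rightarrow> ('h \<Rightarrow>\<^sub>L 'h)) \<Rightarrow> ('h \<Rightarrow>\<^sub>L 'h)"

definition has_free_series :: "('n::finite, 'h::chilbert_space) ncfun \<Rightarrow> ('n list \<Rightarrow> complex) \<Rightarrow> bool"
  where
  "has_free_series f a \<longleftrightarrow>
     f \<in> extensional nc_ball \<and>
     limsup (\<lambda>k. ereal (root (2 * k) (\<Sum>\<alpha> | length \<alpha> = k. (cmod (a \<alpha>))\<^sup>2))) \<le> 1 \<and>
     (\<forall>X\<in>nc_ball. (\<lambda>k. \<Sum>\<alpha> | length \<alpha> = k. scale_op (a \<alpha>) (word_op X \<alpha>)) sums f X)"

definition free_holomorphic :: "('n::finite, 'h::chilbert_space) ncfun \<Rightarrow> bool" where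
  "free_holomorphic f \<longleftrightarrow> (\<exists>a. has_free_series f a)"

text \<open>The coefficients are unique when the Hilbert space is infinite dimensional.\<close>

definition free_coeff :: "('n::finite, 'h::chilbert_space) ncfun \<Rightarrow> 'n list \<Rightarrow> complex" where
  "free_coeff f = (THE a. has_free_series f a)"

definition free_self_map :: "('n::finite \<Rightarrow> ('n, 'h::chilbert_space) ncfun) \<Rightarrow> bool" where
  "free_self_map \<phi> \<longleftrightarrow>
     (\<forall>i. free_holomorphic (\<phi> i)) \<and> (\<forall>X\<in>nc_ball. (\<lambda>i. \<phi> i X) \<in> nc_ball)"

definition map_word :: "('n::finite \<Rightarrow> ('n, 'h::chilbert_space) ncfun) \<Rightarrow> 'n list \<Rightarrow> ('n, 'h) ncfun"
  where
  "map_word \<phi> \<alpha> = (\<lambda>X\<in>nc_ball. word_op (\<lambda>i. \<phi> i X) \<alpha>)"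

definition comp_op ::
  "('n::finite \<Rightarrow> ('n, 'h::chilbert_space) ncfun) \<Rightarrow> ('n, 'h) ncfun \<Rightarrow> ('n, 'h) ncfun" where
  "comp_op \<phi> f =
     (\<lambda>X\<in>nc_ball. \<Sum>k. \<Sum>\<alpha> | length \<alpha> = k. scale_op (free_coeff f \<alpha>) (map_word \<phi> \<alpha> X))"

section \<open>The Hilbert space of free holomorphic functions\<close>

definition H2_ball :: "('n::finite, 'h::chilbert_space) ncfun set" where
  "H2_ball = {f. free_holomorphic f \<and> (\<lambda>\<alpha>. (cmod (free_coeff f \<alpha>))\<^sup>2) summable_on UNIV}"

definition H2_inner :: "('n::finite, 'h::chilbert_space) ncfun \<Rightarrow> ('n, 'h) ncfun \<Rightarrow> complex" where
  "H2_inner f g = (\<Sum>\<^sub>\<infinity>\<alpha>. free_coeff f \<alpha> * cnj (free_coeff g \<alpha>))"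

definition H2_norm :: "('n::finite, 'h::chilbert_space) ncfun \<Rightarrow> real" where
  "H2_norm f = sqrt (Re (H2_inner f f))"

definition H2_bounded_operator ::
  "(('n::finite, 'h::chilbert_space) ncfun \<Rightarrow> ('n, 'h) ncfun) \<Rightarrow> bool" where
  "H2_bounded_operator T \<longleftrightarrow>
     (\<forall>f\<in>H2_ball. T f \<in> H2_ball) \<and>
     (\<forall>f\<in>H2_ball. \<forall>g\<in>H2_ball.
        T (\<lambda>X\<in>nc_ball. f X + g X) = (\<lambda>X\<in>nc_ball. T f X + T g X)) \<and>
     (\<forall>c. \<forall>f\<in>H2_ball. T (\<lambda>X\<in>nc_ball. scale_op c (f X)) = (\<lambda>X\<in>nc_ball. scale_op c (T f X))) \<and>
     (\<exists>K. \<forall>f\<in>H2_ball. H2_norm (T f) \<le> K * H2_norm f)"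

text \<open>Adjoints are defined for bounded operators only: if \<open>T\<close> is not a bounded operator on
  \<^term>\<open>H2_ball\<close>, then no \<open>S\<close> is its adjoint. Values of \<open>S\<close> outside \<^term>\<open>H2_ball\<close> are fixed to
  \<^term>\<open>undefined\<close> for uniqueness.\<close>

definition is_H2_adjoint ::
  "(('n::finite, 'h::chilbert_space) ncfun \<Rightarrow> ('n, 'h) ncfun) \<Rightarrow>
   (('n, 'h) ncfun \<Rightarrow> ('n, 'h) ncfun) \<Rightarrow> bool" where
  "is_H2_adjoint T S \<longleftrightarrow>
     H2_bounded_operator T \<and> H2_bounded_operator S \<and> S \<in> extensional H2_ball \<and>
     (\<forall>f\<in>H2_ball. \<forall>g\<in>H2_ball. H2_inner (T f) g = H2_inner f (S g))"

definition H2_adjoint ::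
  "(('n::finite, 'h::chilbert_space) ncfun \<Rightarrow> ('n, 'h) ncfun) \<Rightarrow>
   (('n, 'h) ncfun \<Rightarrow> ('n, 'h) ncfun)" where
  "H2_adjoint T = (THE S. is_H2_adjoint T S)"

end

theory Submission
  imports Defs
begin

text \<open>The only hard point is that \<open>C\<^sub>\<phi>\<close> is bounded; then \<open>\<langle>C\<^sub>\<phi>\<^sup>* f, X\<^sub>\<alpha>\<rangle> = \<langle>f, \<phi>\<^sub>\<alpha>\<rangle>\<close> is read off the adjoint
  relation. Evaluating \<open>\<phi>\<close> at truncated weighted left shifts \<open>r S\<close> and letting \<open>r \<rightarrow> 1\<close> shows that
  left multiplication by the row \<open>(\<phi>\<^sub>1, \<dots>, \<phi>\<^sub>n)\<close> is a contraction on square summable coefficient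
  families. Put \<open>\<lambda> = \<phi>(0)\<close> and \<open>A f = (f \<circ> \<phi>) - (f\<cdot>l \<circ> \<phi>)\<close>, where \<open>l = \<Sum>\<^sub>i cnj \<lambda>\<^sub>i X\<^sub>i\<close>. The splitting
  \<open>f = f\<^sub>0 + \<Sum>\<^sub>i X\<^sub>i f\<^sub>i\<close> gives \<open>A f = f\<^sub>0 (1 - \<Sum>\<^sub>i cnj \<lambda>\<^sub>i \<phi>\<^sub>i) + \<Sum>\<^sub>i \<phi>\<^sub>i A f\<^sub>i\<close>, and Littlewood's induction on
  the degree shows \<open>\<parallel>A f\<parallel>\<^sup>2 \<le> (1 - \<parallel>\<lambda>\<parallel>\<^sup>2) \<parallel>f\<parallel>\<^sup>2\<close> for polynomials. Right multiplication by \<open>l\<close> has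
  norm \<open>\<parallel>\<lambda>\<parallel> < 1\<close>, so iterating \<open>f \<circ> \<phi> = A f + (f\<cdot>l \<circ> \<phi>)\<close> bounds \<open>C\<^sub>\<phi>\<close> by \<open>1 / (1 - \<parallel>\<lambda>\<parallel>)\<close>.\<close>

section \<open>Row contractions on a complex Hilbert space\<close>

text \<open>\<open>H2_adjoint\<close> is given by a \<open>THE\<close>, and
  \<open>is_H2_adjoint\<close> demands that both operators be bounded, so nothing can be read off
  before boundedness is proved. If \<phi>(0) = 0, then products with \<phi>_i on the left have no
  constant term, the constant term of f is orthogonal to the rest of the composite, and Littlewood's
  induction is immediate. For \<lambda> = \<phi>(0) different from 0 a cross term appears. The
  factor 1 - l is the inverse of the reproducing kernel at \<lambda>, and multiplying by it before
  composing cancels that cross term exactly. The price is that l raises the degree: the iteration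
  never closes up on polynomials of a fixed degree, and its remainder needs an a priori bound. A
  bound growing linearly in the degree is enough, since the remainder after J rounds carries the
  factor \<open>r0 ^ J\<close>. All estimates concern coefficients of degree at most some N. Higher
  degrees of a factor never influence lower degrees of a product, so finite sums suffice, limits are
  taken coefficientwise, and finitely many orthonormal vectors of H are enough to realise the
  shifts.\<close>

lemma cinner_add_right: "cinner x (y + z) = cinner x y + cinner x (z :: 'h::chilbert_space)"
  by (metis cinner_add_left cinner_commute complex_cnj_add)

lemma cinner_scaleC_right: "cinner x (c *\<^sub>C y) = cnj c * cinner x (y :: 'h::chilbert_space)"
  by (metis cinner_commute cinner_scaleC_left complex_cnj_mult)

lemma cinner_zero_left [simp]: "cinner 0 (x :: 'h::chilbert_space) = 0"
  using cinner_add_left[of 0 0 x] by simp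

lemma cinner_zero_right [simp]: "cinner (x :: 'h::chilbert_space) 0 = 0"
  using cinner_add_right[of x 0 0] by simp

lemma cinner_diff_left: "cinner (x - y) z = cinner x z - cinner y (z :: 'h::chilbert_space)"
  using cinner_add_left[of "x - y" y z] by simp

lemma cinner_sum_left: "cinner (\<Sum>i\<in>A. f i) (z :: 'h::chilbert_space) = (\<Sum>i\<in>A. cinner (f i) z)"
  by (induction A rule: infinite_finite_induct) (simp_all add: cinner_add_left)

lemma cinner_sum_right: "cinner (z :: 'h::chilbert_space) (\<Sum>i\<in>A. f i) = (\<Sum>i\<in>A. cinner z (f i))"
  by (induction A rule: infinite_finite_induct) (simp_all add: cinner_add_right)

lemma scaleC_zero [simp]: "c *\<^sub>C 0 = (0 :: 'h::chilbert_space)" "0 *\<^sub>C x = (0 :: 'h)"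
  using scaleC_add_right[of c 0 "0::'h"] scaleC_add_left[of 0 0 x] by simp_all

lemma scaleC_one [simp]: "1 *\<^sub>C x = (x :: 'h::chilbert_space)"
  using scaleC_of_real[of 1 x] by simp

lemma scaleC_sum_right: "c *\<^sub>C (\<Sum>i\<in>A. f i) = (\<Sum>i\<in>A. c *\<^sub>C (f i :: 'h::chilbert_space))"
  by (induction A rule: infinite_finite_induct) (simp_all add: scaleC_add_right)

lemma scaleC_sum_left: "(\<Sum>i\<in>A. f i) *\<^sub>C x = (\<Sum>i\<in>A. f i *\<^sub>C (x :: 'h::chilbert_space))"
  by (induction A rule: infinite_finite_induct) (simp_all add: scaleC_add_left)

lemma scaleC_scaleR: "c *\<^sub>C (r *\<^sub>R x) = r *\<^sub>R (c *\<^sub>C (x :: 'h::chilbert_space))"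
  by (simp add: scaleC_of_real[symmetric] scaleC_scaleC mult.commute)

lemma cinner_extensionality:
  assumes "\<And>x. cinner x y = cinner x (z :: 'h::chilbert_space)"
  shows "y = z"
proof -
  have "inner x y = inner x z" for x
    by (simp add: inner_eq_Re_cinner assms)
  then show ?thesis
    by (metis inner_commute vector_eq_rdot)
qed

lemma cinner_Cauchy_Schwarz: "cmod (cinner x y) \<le> norm x * norm (y :: 'h::chilbert_space)"
proof (cases "cinner x y = 0")
  case False
  \<comment> \<open>A unimodular multiple of \<open>x\<close> makes the complex inner product real
    and nonnegative, so the real Cauchy-Schwarz inequality applies.\<close>
  define u where "u = cnj (cinner x y) / cmod (cinner x y)"
  have u: "cmod u = 1"
    using False by (simp add: u_def norm_divide)
  have "cinner (u *\<^sub>C x) y = cmod (cinner x y)"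
    using False
    by (simp add: cinner_scaleC_left u_def mult.commute[of "cnj _"] complex_norm_square[symmetric]
        power2_eq_square)
  then have "cmod (cinner x y) = inner (u *\<^sub>C x) y"
    by (simp add: inner_eq_Re_cinner)
  also have "\<dots> \<le> norm (u *\<^sub>C x) * norm y"
    by (rule norm_cauchy_schwarz)
  finally show ?thesis
    by (simp add: norm_scaleC u)
qed simp

text \<open>The representing vector is the minimiser of \<open>\<parallel>x\<parallel>\<^sup>2 - 2 f x\<close>; minimising sequences are
  Cauchy by the parallelogram law.\<close>

theorem Riesz_representation:
  fixes f :: "'a::{real_inner,complete_space} \<Rightarrow> real"
  assumes "bounded_linear f"
  shows "\<exists>z. \<forall>x. f x = inner x z"
proof -
  interpret f: bounded_linear f by fact
  obtain K where K: "\<And>x. norm (f x) \<le> norm x * K"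
    using f.bounded by blast
  define J where "J x = (norm x)\<^sup>2 - 2 * f x" for x
  have "- K\<^sup>2 \<le> J x" for x
  proof -
    have "0 \<le> (norm x - K)\<^sup>2" by simp
    then show ?thesis
      using K[of x] by (simp add: J_def power2_diff)
  qed
  then have bdd: "bdd_below (range J)"
    by (auto simp: bdd_below_def)
  define m where "m = Inf (range J)"
  have m_le: "m \<le> J x" for x
    unfolding m_def by (rule cInf_lower) (use bdd in auto)
  have "\<exists>x. J x < m + inverse (real (Suc n))" for n
  proof -
    have "Inf (range J) < m + inverse (real (Suc n))"
      by (simp add: m_def)
    then show ?thesis
      using cInf_less_iff[of "range J"] bdd by auto
  qed
  then obtain s where s: "\<And>n. J (s n) < m + inverse (real (Suc n))"
    by metis
  have par: "(norm (x - y))\<^sup>2 \<le> 2 * (J x - m) + 2 * (J y - m)" for x y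
  proof -
    have "(norm (x - y))\<^sup>2 = 2 * J x + 2 * J y - 4 * J ((1/2) *\<^sub>R (x + y))"
      by (simp add: J_def power2_norm_eq_inner inner_simps f.scaleR f.add power_mult_distrib
          power_divide inner_commute algebra_simps)
    then show ?thesis
      using m_le[of "(1/2) *\<^sub>R (x + y)"] by simp
  qed
  have "Cauchy s"
  proof (rule metric_CauchyI)
    fix e :: real assume "0 < e"
    then obtain M where M: "inverse (real (Suc M)) < e\<^sup>2 / 4"
      using reals_Archimedean[of "e\<^sup>2 / 4"] by auto
    have close: "J (s n) - m < e\<^sup>2 / 4" if "n \<ge> M" for n
    proof -
      have "inverse (real (Suc n)) \<le> inverse (real (Suc M))"
        using that by simp
      then show ?thesis
        using s[of n] M by linarith
    qed
    have "dist (s i) (s j) < e" if "i \<ge> M" "j \<ge> M" for i j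
    proof -
      have "(norm (s i - s j))\<^sup>2 < e\<^sup>2"
        using par[of "s i" "s j"] close[OF that(1)] close[OF that(2)] by argo
      then show ?thesis
        using \<open>0 < e\<close> by (simp add: dist_norm power_less_imp_less_base)
    qed
    then show "\<exists>M. \<forall>i\<ge>M. \<forall>j\<ge>M. dist (s i) (s j) < e"
      by blast
  qed
  then obtain z where z: "s \<longlonglongrightarrow> z"
    using Cauchy_convergent convergent_def by blast
  have "(\<lambda>n. J (s n)) \<longlonglongrightarrow> J z"
    unfolding J_def by (intro tendsto_intros f.tendsto z)
  moreover have "(\<lambda>n. J (s n)) \<longlonglongrightarrow> m"
  proof (rule tendsto_sandwich[of "\<lambda>n. m" _ _ "\<lambda>n. m + inverse (real (Suc n))"])
    show "(\<lambda>n. m + inverse (real (Suc n))) \<longlonglongrightarrow> m"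
      using tendsto_add[OF tendsto_const[of m] LIMSEQ_inverse_real_of_nat] by simp
  qed (use m_le s less_imp_le in \<open>auto intro!: always_eventually\<close>)
  ultimately have Jz: "J z = m"
    by (rule LIMSEQ_unique)
  have "f h = inner h z" for h
  proof (rule ccontr)
    assume ne: "f h \<noteq> inner h z"
    define d where "d = inner h z - f h"
    define q where "q = (norm h)\<^sup>2 + 1"
    \<comment> \<open>The minimiser of \<open>2 * t * d + t\<^sup>2 * q\<close>; the summand 1 in
      \<open>q\<close> keeps the quotient meaningful when \<open>h = 0\<close>.\<close>
    define t where "t = - (d / q)"
    have q: "q \<ge> 1" by (simp add: q_def)
    have "(norm (z + t *\<^sub>R h))\<^sup>2 = (norm z)\<^sup>2 + 2 * t * inner h z + t\<^sup>2 * (norm h)\<^sup>2"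
      unfolding power2_norm_eq_inner
      by (simp add: inner_simps inner_commute power2_eq_square algebra_simps)
    then have "J (z + t *\<^sub>R h) = J z + 2 * t * d + t\<^sup>2 * (norm h)\<^sup>2"
      by (simp add: J_def d_def f.add f.scaleR algebra_simps)
    then have "0 \<le> 2 * t * d + t\<^sup>2 * (norm h)\<^sup>2"
      using m_le[of "z + t *\<^sub>R h"] Jz by simp
    also have "\<dots> \<le> 2 * t * d + t\<^sup>2 * q"
      by (simp add: q_def mult_left_mono)
    also have "\<dots> = - (d\<^sup>2 / q)"
      using q by (simp add: t_def power2_eq_square field_simps)
    finally show False
      using ne q by (simp add: d_def divide_le_0_iff)
  qed
  then show ?thesis by blast
qed

section \<open>Adjoint operators and the norm of a row\<close>

lemma op_adj_exists:
  assumes T: "T \<in> (BH :: ('h::chilbert_space \<Rightarrow>\<^sub>L 'h) set)"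
  shows "\<exists>S. S \<in> BH \<and> (\<forall>x y. cinner (blinfun_apply T x) y = cinner x (blinfun_apply S y))"
proof -
  have "\<exists>z. \<forall>x. cinner (T x) y = cinner x z" for y
  proof -
    have "bounded_linear (\<lambda>x. inner (T x) y)"
      by (intro bounded_linear_intros)
    then obtain z where z: "\<And>x. inner (T x) y = inner x z"
      using Riesz_representation by blast
    have "cinner (T x) y = cinner x z" for x
    proof (rule complex_eqI)
      show "Re (cinner (T x) y) = Re (cinner x z)"
        using z[of x] by (simp add: inner_eq_Re_cinner)
      \<comment> \<open>The choice of \<open>z\<close> settles real parts only; its defining
        identity at \<open>\<i> *\<^sub>C x\<close> yields the imaginary part.\<close>
      have "T (\<i> *\<^sub>C x) = \<i> *\<^sub>C T x"
        using T by (simp add: BH_def)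
      then show "Im (cinner (T x) y) = Im (cinner x z)"
        using z[of "\<i> *\<^sub>C x"] by (simp add: inner_eq_Re_cinner cinner_scaleC_left)
    qed
    then show ?thesis by blast
  qed
  then obtain S where S: "\<And>x y. cinner (T x) y = cinner x (S y)"
    by metis
  have add: "S (x + y) = S x + S y" for x y
    by (rule cinner_extensionality) (simp add: S[symmetric] cinner_add_right)
  have scale: "S (c *\<^sub>C x) = c *\<^sub>C S x" for c x
    by (rule cinner_extensionality) (simp add: S[symmetric] cinner_scaleC_right)
  have bound: "norm (S y) \<le> norm y * norm T" for y
  proof -
    have "(norm (S y))\<^sup>2 = cmod (cinner (T (S y)) y)"
      by (simp add: S cinner_self norm_power)
    also have "\<dots> \<le> norm (T (S y)) * norm y"
      by (rule cinner_Cauchy_Schwarz)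
    also have "\<dots> \<le> norm T * norm (S y) * norm y"
      by (intro mult_right_mono norm_blinfun) simp
    finally have "norm (S y) * norm (S y) \<le> (norm y * norm T) * norm (S y)"
      by (simp add: power2_eq_square mult_ac)
    then show ?thesis
      by (cases "norm (S y) = 0") auto
  qed
  have bl: "bounded_linear S"
    by (rule bounded_linear_intro[OF add _ bound]) (metis scale scaleC_of_real)
  show ?thesis
    by (rule exI[of _ "Blinfun S"]) (simp add: bounded_linear_Blinfun_apply[OF bl] BH_def scale S)
qed

lemma op_adj:
  assumes T: "T \<in> (BH :: ('h::chilbert_space \<Rightarrow>\<^sub>L 'h) set)"
  shows "cinner (blinfun_apply T x) y = cinner x (blinfun_apply (op_adj T) y)"
proof -
  have "\<exists>!S. S \<in> BH \<and> (\<forall>x y. cinner (blinfun_apply T x) y = cinner x (blinfun_apply S y))"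
  proof (rule ex_ex1I[OF op_adj_exists[OF T]])
    fix S S'
    assume "S \<in> BH \<and> (\<forall>x y. cinner (T x) y = cinner x (blinfun_apply S y))"
      "S' \<in> BH \<and> (\<forall>x y. cinner (T x) y = cinner x (blinfun_apply S' y))"
    then show "S = S'"
      by (intro blinfun_eqI cinner_extensionality) metis
  qed
  from theI'[OF this] show ?thesis
    unfolding op_adj_def[symmetric] by blast
qed

text \<open>The row (X_1, ..., X_n), as an operator from the n-fold direct sum of H to H, has norm
  at most \<open>r\<close>. This form without adjoints can be applied once per letter of a
  word.\<close>

definition row_bound :: "real \<Rightarrow> ('n::finite \<Rightarrow> ('h::chilbert_space \<Rightarrow>\<^sub>L 'h)) \<Rightarrow> bool" where
  "row_bound r X \<longleftrightarrow> 0 \<le> r \<and> (\<forall>y. (norm (\<Sum>i\<in>UNIV. X i (y i)))\<^sup>2 \<le> r\<^sup>2 * (\<Sum>i\<in>UNIV. (norm (y i))\<^sup>2))"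

text \<open>With W the row times its adjoint column, the sum equals \<open>cinner (W z) z\<close>,
  to which Cauchy-Schwarz applies.\<close>

lemma sum_op_adj_sq:
  fixes X :: "'n::finite \<Rightarrow> ('h::chilbert_space \<Rightarrow>\<^sub>L 'h)"
  assumes "\<And>i. X i \<in> BH"
  shows "(\<Sum>i\<in>UNIV. (norm (op_adj (X i) z))\<^sup>2)
    \<le> norm ((\<Sum>i\<in>UNIV. X i o\<^sub>L op_adj (X i)) z) * norm z"
proof -
  have "complex_of_real (\<Sum>i\<in>UNIV. (norm (op_adj (X i) z))\<^sup>2)
      = cinner ((\<Sum>i\<in>UNIV. X i o\<^sub>L op_adj (X i)) z) z"
    by (simp add: blinfun.sum_left cinner_sum_left op_adj[OF assms] cinner_self)
  then have "cmod (complex_of_real (\<Sum>i\<in>UNIV. (norm (op_adj (X i) z))\<^sup>2))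
      \<le> norm ((\<Sum>i\<in>UNIV. X i o\<^sub>L op_adj (X i)) z) * norm z"
    by (metis cinner_Cauchy_Schwarz)
  then show ?thesis
    by (simp only: norm_of_real abs_of_nonneg sum_nonneg zero_le_power2)
qed

text \<open>A row and its adjoint column have the same norm. If \<open>z\<close> is the image of
  \<open>y\<close>, then \<open>(norm z)\<^sup>2\<close> is the pairing of \<open>y\<close> with the
  column at \<open>z\<close>, whose norm is at most \<open>r * norm z\<close> by
  \<open>sum_op_adj_sq\<close>; one factor \<open>norm z\<close> cancels.\<close>

lemma nc_ball_row_bound:
  fixes X :: "'n::finite \<Rightarrow> ('h::chilbert_space \<Rightarrow>\<^sub>L 'h)"
  assumes X: "X \<in> nc_ball"
  shows "\<exists>r<1. row_bound r X"
proof -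
  define W where "W = (\<Sum>i\<in>UNIV. X i o\<^sub>L op_adj (X i))"
  define r where "r = sqrt (norm W)"
  have BH: "\<And>i. X i \<in> BH" and r1: "r < 1"
    using X by (auto simp: nc_ball_def r_def W_def)
  have "(norm (\<Sum>i\<in>UNIV. X i (y i)))\<^sup>2 \<le> r\<^sup>2 * (\<Sum>i\<in>UNIV. (norm (y i))\<^sup>2)" for y
  proof -
    define z where "z = (\<Sum>i\<in>UNIV. X i (y i))"
    define A where "A = L2_set (\<lambda>i. norm (y i)) UNIV"
    define B where "B = L2_set (\<lambda>i. norm (op_adj (X i) z)) UNIV"
    have AB: "A \<ge> 0" "B \<ge> 0" by (simp_all add: A_def B_def)
    have "complex_of_real ((norm z)\<^sup>2) = (\<Sum>i\<in>UNIV. cinner (y i) (op_adj (X i) z))"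
      unfolding cinner_self[symmetric] op_adj[OF BH, symmetric] cinner_sum_left[symmetric]
      by (simp add: z_def)
    then have "(norm z)\<^sup>2 = cmod (\<Sum>i\<in>UNIV. cinner (y i) (op_adj (X i) z))"
      by (metis norm_of_real abs_of_nonneg zero_le_power2)
    also have "\<dots> \<le> (\<Sum>i\<in>UNIV. \<bar>norm (y i)\<bar> * \<bar>norm (op_adj (X i) z)\<bar>)"
      by (rule sum_norm_le) (simp add: cinner_Cauchy_Schwarz)
    also have "\<dots> \<le> A * B"
      unfolding A_def B_def by (rule L2_set_mult_ineq)
    finally have zAB: "(norm z)\<^sup>2 \<le> A * B" .
    have "B\<^sup>2 \<le> norm (W z) * norm z"
      using sum_op_adj_sq[OF BH, where z = z] by (simp add: B_def L2_set_def sum_nonneg W_def)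
    also have "\<dots> \<le> (norm W * norm z) * norm z"
      by (intro mult_right_mono norm_blinfun) simp
    finally have "B\<^sup>2 \<le> (r * norm z)\<^sup>2"
      by (simp add: r_def power_mult_distrib) (simp add: power2_eq_square)
    then have "B \<le> r * norm z"
      by (rule power2_le_imp_le) (simp add: r_def)
    then have "norm z * norm z \<le> (r * A) * norm z"
      using zAB mult_left_mono[of B "r * norm z" A] AB by (simp add: power2_eq_square mult_ac)
    then have "norm z \<le> r * A"
      using AB by (cases "norm z = 0") (auto simp: r_def)
    then have "(norm z)\<^sup>2 \<le> (r * A)\<^sup>2"
      by (intro power_mono) auto
    then show ?thesis
      by (simp add: z_def A_def power_mult_distrib L2_set_def sum_nonneg)
  qed
  moreover have "0 \<le> r"
    by (simp add: r_def)
  ultimately show ?thesis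
    using r1 unfolding row_bound_def by blast
qed

text \<open>Feeding the row with the adjoint column at \<open>z\<close> bounds \<open>W z\<close> in
  terms of itself, and one factor \<open>norm (W z)\<close> cancels.\<close>

lemma row_bound_nc_ball:
  fixes X :: "'n::finite \<Rightarrow> ('h::chilbert_space \<Rightarrow>\<^sub>L 'h)"
  assumes BH: "\<And>i. X i \<in> BH" and r: "row_bound r X" "r < 1"
  shows "X \<in> nc_ball"
proof -
  define W where "W = (\<Sum>i\<in>UNIV. X i o\<^sub>L op_adj (X i))"
  have "norm (W z) \<le> r\<^sup>2 * norm z" for z
  proof -
    have "(norm (W z))\<^sup>2 \<le> r\<^sup>2 * (\<Sum>i\<in>UNIV. (norm (op_adj (X i) z))\<^sup>2)"
      using r(1) by (simp add: row_bound_def W_def blinfun.sum_left)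
    also have "\<dots> \<le> r\<^sup>2 * (norm (W z) * norm z)"
      unfolding W_def by (intro mult_left_mono sum_op_adj_sq BH) simp
    finally have "norm (W z) * norm (W z) \<le> (r\<^sup>2 * norm z) * norm (W z)"
      by (simp add: power2_eq_square mult_ac)
    then show ?thesis
      by (cases "norm (W z) = 0") auto
  qed
  then have "norm W \<le> r\<^sup>2"
    by (intro norm_blinfun_bound) auto
  also have "\<dots> < 1"
    using r by (simp add: row_bound_def power_less_one_iff)
  finally show ?thesis
    using BH by (simp add: nc_ball_def W_def)
qed

section \<open>Square summable families indexed by words\<close>

lemma finite_length_le [simp]: "finite {\<alpha> :: 'n::finite list. length \<alpha> \<le> d}"
  using finite_lists_length_le[of "UNIV :: 'n set" d] by simp

lemma finite_length_eq [simp]: "finite {\<alpha> :: 'n::finite list. length \<alpha> = d}"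
  by (rule finite_subset[OF _ finite_length_le[of d]]) auto

lemma sum_length_Suc:
  fixes f :: "'n::finite list \<Rightarrow> 'b::comm_monoid_add"
  shows "(\<Sum>\<alpha> | length \<alpha> = Suc k. f \<alpha>) = (\<Sum>i\<in>UNIV. \<Sum>\<alpha> | length \<alpha> = k. f (i # \<alpha>))"
proof -
  have "(\<Sum>\<alpha> | length \<alpha> = Suc k. f \<alpha>)
      = (\<Sum>(i, \<alpha>) \<in> UNIV \<times> {\<alpha>. length \<alpha> = k}. f (i # \<alpha>))"
    by (rule sum.reindex_bij_witness[of _ "\<lambda>(i, \<alpha>). i # \<alpha>" "\<lambda>\<alpha>. (hd \<alpha>, tl \<alpha>)"])
      (auto simp: length_Suc_conv)
  then show ?thesis
    by (simp add: sum.cartesian_product)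
qed

lemma sum_length_le_Suc:
  fixes f :: "'n::finite list \<Rightarrow> 'b::comm_monoid_add"
  shows "(\<Sum>\<alpha> | length \<alpha> \<le> Suc d. f \<alpha>) = f [] + (\<Sum>i\<in>UNIV. \<Sum>\<alpha> | length \<alpha> \<le> d. f (i # \<alpha>))"
proof -
  have "{\<alpha> :: 'n list. length \<alpha> \<le> Suc d} = insert [] (case_prod Cons ` (UNIV \<times> {\<alpha>. length \<alpha> \<le> d}))"
  proof (intro equalityI subsetI)
    fix \<alpha> :: "'n list" assume "\<alpha> \<in> {\<alpha>. length \<alpha> \<le> Suc d}"
    then show "\<alpha> \<in> insert [] (case_prod Cons ` (UNIV \<times> {\<alpha>. length \<alpha> \<le> d}))"
      by (cases \<alpha>) auto
  qed auto
  then have "(\<Sum>\<alpha> | length \<alpha> \<le> Suc d. f \<alpha>)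
      = f [] + sum f (case_prod Cons ` ((UNIV :: 'n set) \<times> {\<alpha>. length \<alpha> \<le> d}))"
    by (simp only:) (subst sum.insert, auto)
  also have "sum f (case_prod Cons ` (UNIV \<times> {\<alpha>. length \<alpha> \<le> d}))
      = (\<Sum>(i, \<alpha>) \<in> UNIV \<times> {\<alpha>. length \<alpha> \<le> d}. f (i # \<alpha>))"
    by (subst sum.reindex) (auto simp: inj_on_def case_prod_beta intro!: sum.cong)
  finally show ?thesis
    by (simp add: sum.cartesian_product)
qed

lemma finite_length_bound:
  assumes "finite F"
  shows "\<exists>d. \<forall>\<alpha>\<in>F. length \<alpha> \<le> d"
  using finite_nat_set_iff_bounded_le[of "length ` F"] assms by auto

lemma summable_on_length_tendsto:
  fixes f :: "'n::finite list \<Rightarrow> 'b::{comm_monoid_add,t2_space}"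
  assumes "f summable_on UNIV"
  shows "(\<lambda>d. \<Sum>\<alpha> | length \<alpha> \<le> d. f \<alpha>) \<longlonglongrightarrow> infsum f UNIV"
proof -
  have "filterlim (\<lambda>d. {\<alpha> :: 'n list. length \<alpha> \<le> d}) (finite_subsets_at_top UNIV) sequentially"
  proof (unfold filterlim_finite_subsets_at_top, intro allI impI)
    fix F :: "'n list set" assume "finite F \<and> F \<subseteq> UNIV"
    then obtain d where "\<And>\<alpha>. \<alpha> \<in> F \<Longrightarrow> length \<alpha> \<le> d"
      using finite_length_bound by blast
    then show "\<forall>\<^sub>F m in sequentially. finite {\<alpha> :: 'n list. length \<alpha> \<le> m} \<and>
        F \<subseteq> {\<alpha>. length \<alpha> \<le> m} \<and> {\<alpha> :: 'n list. length \<alpha> \<le> m} \<subseteq> UNIV"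
      by (intro eventually_sequentiallyI[of d]) (auto intro: order_trans)
  qed
  moreover have "(sum f \<longlongrightarrow> infsum f UNIV) (finite_subsets_at_top UNIV)"
    using has_sum_infsum[OF assms] by (simp add: has_sum_def)
  ultimately show ?thesis
    using filterlim_compose by blast
qed

section \<open>Truncated and full square norms of coefficient families\<close>

definition trunc_sq :: "nat \<Rightarrow> ('n::finite list \<Rightarrow> complex) \<Rightarrow> real" where
  "trunc_sq d a = (\<Sum>\<alpha> | length \<alpha> \<le> d. (cmod (a \<alpha>))\<^sup>2)"

definition trunc_norm :: "nat \<Rightarrow> ('n::finite list \<Rightarrow> complex) \<Rightarrow> real" where
  "trunc_norm d a = sqrt (trunc_sq d a)"

definition ell2 :: "('n::finite list \<Rightarrow> complex) \<Rightarrow> bool" where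
  "ell2 a \<longleftrightarrow> (\<lambda>\<alpha>. (cmod (a \<alpha>))\<^sup>2) summable_on UNIV"

definition ell2_sq :: "('n::finite list \<Rightarrow> complex) \<Rightarrow> real" where
  "ell2_sq a = (\<Sum>\<^sub>\<infinity>\<alpha>. (cmod (a \<alpha>))\<^sup>2)"

definition ell2_inner :: "('n::finite list \<Rightarrow> complex) \<Rightarrow> ('n list \<Rightarrow> complex) \<Rightarrow> complex" where
  "ell2_inner a b = (\<Sum>\<^sub>\<infinity>\<alpha>. a \<alpha> * cnj (b \<alpha>))"

lemma trunc_sq_nonneg [simp]: "0 \<le> trunc_sq d a"
  by (simp add: trunc_sq_def sum_nonneg)

lemma trunc_norm_nonneg [simp]: "0 \<le> trunc_norm d a"
  by (simp add: trunc_norm_def)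

lemma trunc_norm_sq: "(trunc_norm d a)\<^sup>2 = trunc_sq d a"
  by (simp add: trunc_norm_def)

lemma trunc_sq_0 [simp]: "trunc_sq 0 a = (cmod (a []))\<^sup>2"
  by (simp add: trunc_sq_def)

lemma trunc_sq_Suc: "trunc_sq (Suc d) a = (cmod (a []))\<^sup>2 + (\<Sum>i\<in>UNIV. trunc_sq d (\<lambda>\<alpha>. a (i # \<alpha>)))"
  by (simp add: trunc_sq_def sum_length_le_Suc)

lemma trunc_sq_mono: "d \<le> m \<Longrightarrow> trunc_sq d a \<le> trunc_sq m a"
  unfolding trunc_sq_def by (rule sum_mono2) auto

lemma trunc_norm_L2_set: "trunc_norm d a = L2_set (\<lambda>\<alpha>. cmod (a \<alpha>)) {\<alpha>. length \<alpha> \<le> d}"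
  by (simp add: trunc_norm_def trunc_sq_def L2_set_def)

lemma trunc_norm_triangle: "trunc_norm d (\<lambda>\<alpha>. a \<alpha> + b \<alpha>) \<le> trunc_norm d a + trunc_norm d b"
proof -
  have "trunc_norm d (\<lambda>\<alpha>. a \<alpha> + b \<alpha>) \<le> L2_set (\<lambda>\<alpha>. cmod (a \<alpha>) + cmod (b \<alpha>)) {\<alpha>. length \<alpha> \<le> d}"
    unfolding trunc_norm_L2_set by (rule L2_set_mono) (auto intro: norm_triangle_ineq)
  also have "\<dots> \<le> trunc_norm d a + trunc_norm d b"
    unfolding trunc_norm_L2_set by (rule L2_set_triangle_ineq)
  finally show ?thesis .
qed

lemma trunc_sq_scale: "trunc_sq d (\<lambda>\<alpha>. c * a \<alpha>) = (cmod c)\<^sup>2 * trunc_sq d a"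
  by (simp add: trunc_sq_def norm_mult power_mult_distrib sum_distrib_left)

lemma cmod_le_trunc_norm: "length \<gamma> \<le> d \<Longrightarrow> cmod (a \<gamma>) \<le> trunc_norm d a"
  unfolding trunc_norm_L2_set by (rule member_le_L2_set) auto

text \<open>Every finite set of words has bounded length, so the truncations control all finite
  partial sums.\<close>

lemma ell2I:
  assumes "\<And>d. trunc_sq d a \<le> B"
  shows "ell2 a" "ell2_sq a \<le> B"
proof -
  have fin: "(\<Sum>\<alpha>\<in>F. (cmod (a \<alpha>))\<^sup>2) \<le> B" if "finite F" for F
  proof -
    obtain d where d: "\<forall>\<alpha>\<in>F. length \<alpha> \<le> d"
      using finite_length_bound[OF \<open>finite F\<close>] by blast
    then have "(\<Sum>\<alpha>\<in>F. (cmod (a \<alpha>))\<^sup>2) \<le> trunc_sq d a"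
      unfolding trunc_sq_def using d by (intro sum_mono2) auto
    with assms show ?thesis
      using order_trans by blast
  qed
  have "(\<lambda>\<alpha>. (cmod (a \<alpha>))\<^sup>2) summable_on UNIV"
    by (rule nonneg_bdd_above_summable_on) (auto simp: bdd_above_def intro!: exI[of _ B] fin)
  then show "ell2 a" "ell2_sq a \<le> B"
    unfolding ell2_def ell2_sq_def by (auto intro: infsum_le_finite_sums fin)
qed

lemma trunc_sq_le_ell2_sq: "ell2 a \<Longrightarrow> trunc_sq d a \<le> ell2_sq a"
  unfolding ell2_def ell2_sq_def trunc_sq_def
  by (rule finite_sum_le_infsum) auto

lemma ell2_sq_nonneg [simp]: "0 \<le> ell2_sq a"
  by (simp add: ell2_sq_def infsum_nonneg)

lemma trunc_sq_tendsto: "ell2 a \<Longrightarrow> (\<lambda>d. trunc_sq d a) \<longlonglongrightarrow> ell2_sq a"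
  unfolding ell2_def ell2_sq_def trunc_sq_def by (rule summable_on_length_tendsto)

lemma trunc_norm_le: "ell2 a \<Longrightarrow> trunc_norm d a \<le> sqrt (ell2_sq a)"
  by (simp add: trunc_norm_def trunc_sq_le_ell2_sq)

lemma ell2_add:
  assumes "ell2 a" "ell2 b"
  shows "ell2 (\<lambda>\<alpha>. a \<alpha> + b \<alpha>)"
proof (rule ell2I)
  fix d
  have "trunc_norm d (\<lambda>\<alpha>. a \<alpha> + b \<alpha>) \<le> sqrt (ell2_sq a) + sqrt (ell2_sq b)"
    using trunc_norm_triangle[of d a b] trunc_norm_le[OF assms(1), of d]
      trunc_norm_le[OF assms(2), of d] by linarith
  then have "(trunc_norm d (\<lambda>\<alpha>. a \<alpha> + b \<alpha>))\<^sup>2 \<le> (sqrt (ell2_sq a) + sqrt (ell2_sq b))\<^sup>2"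
    by (intro power_mono) auto
  then show "trunc_sq d (\<lambda>\<alpha>. a \<alpha> + b \<alpha>) \<le> (sqrt (ell2_sq a) + sqrt (ell2_sq b))\<^sup>2"
    by (simp only: trunc_norm_sq)
qed

lemma ell2_scale: "ell2 a \<Longrightarrow> ell2 (\<lambda>\<alpha>. c * a \<alpha>)"
  by (rule ell2I[of _ "(cmod c)\<^sup>2 * ell2_sq a"])
    (simp add: trunc_sq_scale mult_left_mono trunc_sq_le_ell2_sq)

lemma ell2_diff:
  assumes "ell2 a" "ell2 b"
  shows "ell2 (\<lambda>\<alpha>. a \<alpha> - b \<alpha>)"
  using ell2_add[OF assms(1) ell2_scale[OF assms(2), of "-1"]] by simp

lemma ell2_sum: "(\<And>i. i \<in> I \<Longrightarrow> ell2 (a i)) \<Longrightarrow> ell2 (\<lambda>\<alpha>. \<Sum>i\<in>I. a i \<alpha>)"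
proof (induction I rule: infinite_finite_induct)
  case (insert i I)
  then show ?case
    using ell2_add[of "a i" "\<lambda>\<alpha>. \<Sum>i\<in>I. a i \<alpha>"] by simp
qed (auto intro: ell2I[of _ 0] simp: trunc_sq_def)

lemma ell2_inner_bound:
  assumes "ell2 a" "ell2 b"
  shows "(\<lambda>\<alpha>. a \<alpha> * cnj (b \<alpha>)) summable_on UNIV"
    and "cmod (ell2_inner a b) \<le> sqrt (ell2_sq a) * sqrt (ell2_sq b)"
proof -
  have fin: "(\<Sum>\<alpha>\<in>F. norm (a \<alpha> * cnj (b \<alpha>))) \<le> sqrt (ell2_sq a) * sqrt (ell2_sq b)"
    if "finite F" for F
  proof -
    obtain d where d: "\<forall>\<alpha>\<in>F. length \<alpha> \<le> d"
      using finite_length_bound[OF \<open>finite F\<close>] by blast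
    have "(\<Sum>\<alpha>\<in>F. norm (a \<alpha> * cnj (b \<alpha>))) \<le> (\<Sum>\<alpha> | length \<alpha> \<le> d. norm (a \<alpha> * cnj (b \<alpha>)))"
      using d by (intro sum_mono2) auto
    also have "\<dots> = (\<Sum>\<alpha> | length \<alpha> \<le> d. \<bar>cmod (a \<alpha>)\<bar> * \<bar>cmod (b \<alpha>)\<bar>)"
      by (simp add: norm_mult)
    also have "\<dots> \<le> trunc_norm d a * trunc_norm d b"
      unfolding trunc_norm_L2_set by (rule L2_set_mult_ineq)
    also have "\<dots> \<le> sqrt (ell2_sq a) * sqrt (ell2_sq b)"
      by (intro mult_mono trunc_norm_le assms) auto
    finally show ?thesis .
  qed
  have abs: "(\<lambda>\<alpha>. norm (a \<alpha> * cnj (b \<alpha>))) summable_on UNIV"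
    by (rule nonneg_bdd_above_summable_on)
      (auto simp: bdd_above_def intro!: exI[of _ "sqrt (ell2_sq a) * sqrt (ell2_sq b)"] fin)
  then show "(\<lambda>\<alpha>. a \<alpha> * cnj (b \<alpha>)) summable_on UNIV"
    by (rule abs_summable_summable)
  show "cmod (ell2_inner a b) \<le> sqrt (ell2_sq a) * sqrt (ell2_sq b)"
    unfolding ell2_inner_def
    by (rule order_trans[OF norm_infsum_bound[OF abs] infsum_le_finite_sums[OF abs fin]])
qed

lemma ell2_inner_add_left:
  assumes "ell2 a" "ell2 b" "ell2 c"
  shows "ell2_inner (\<lambda>\<alpha>. a \<alpha> + b \<alpha>) c = ell2_inner a c + ell2_inner b c"
  unfolding ell2_inner_def distrib_right
  by (intro infsum_add ell2_inner_bound assms)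

lemma ell2_inner_scale_left:
  assumes "ell2 a" "ell2 c"
  shows "ell2_inner (\<lambda>\<alpha>. k * a \<alpha>) c = k * ell2_inner a c"
  unfolding ell2_inner_def mult.assoc
  by (intro infsum_cmult_right ell2_inner_bound assms)

lemma ell2_inner_diff_left:
  assumes "ell2 a" "ell2 b" "ell2 c"
  shows "ell2_inner (\<lambda>\<alpha>. a \<alpha> - b \<alpha>) c = ell2_inner a c - ell2_inner b c"
  using ell2_inner_add_left[OF assms(1) ell2_scale[OF assms(2), of "-1"] assms(3)]
    ell2_inner_scale_left[OF assms(2,3), of "-1"] by simp

lemma ell2_inner_sum_left:
  assumes "\<And>i. i \<in> I \<Longrightarrow> ell2 (a i)" "ell2 c"
  shows "ell2_inner (\<lambda>\<alpha>. \<Sum>i\<in>I. a i \<alpha>) c = (\<Sum>i\<in>I. ell2_inner (a i) c)"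
  using assms(1)
proof (induction I rule: infinite_finite_induct)
  case (insert i I)
  then show ?case
    using ell2_inner_add_left[of "a i" "\<lambda>\<alpha>. \<Sum>i\<in>I. a i \<alpha>" c] ell2_sum[of I a] assms(2) by simp
qed (auto simp: ell2_inner_def)

lemma ell2_inner_commute: "ell2_inner a b = cnj (ell2_inner b a)"
  by (simp add: ell2_inner_def flip: infsum_cnj) (simp add: mult.commute)

lemma ell2_inner_self: "ell2_inner a a = complex_of_real (ell2_sq a)"
proof (cases "ell2 a")
  case True
  then have "((\<lambda>\<alpha>. complex_of_real ((cmod (a \<alpha>))\<^sup>2)) has_sum complex_of_real (ell2_sq a)) UNIV"
    unfolding has_sum_of_real_iff ell2_def ell2_sq_def by (rule has_sum_infsum)
  then show ?thesis
    unfolding ell2_inner_def complex_norm_square[symmetric] by (rule infsumI)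
next
  case False
  \<comment> \<open>Neither series converges, so both \<open>infsum\<close> values are the default 0
    and the identity persists.\<close>
  then have "\<not> (\<lambda>\<alpha>. complex_of_real ((cmod (a \<alpha>))\<^sup>2)) summable_on UNIV"
    using summable_on_Re[of "\<lambda>\<alpha>. complex_of_real ((cmod (a \<alpha>))\<^sup>2)" UNIV]
    by (auto simp: ell2_def simp del: of_real_power)
  with False show ?thesis
    unfolding ell2_inner_def ell2_sq_def ell2_def complex_norm_square[symmetric]
    by (simp add: infsum_not_exists del: of_real_power)
qed

section \<open>Formal power series in noncommuting variables\<close>

definition monomial :: "'n list \<Rightarrow> 'n list \<Rightarrow> complex" where
  "monomial \<alpha> \<gamma> = of_bool (\<gamma> = \<alpha>)"

text \<open>The coefficient at \<gamma> of a product of two series: the sum of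
  \<open>a \<alpha> * b \<beta>\<close> over all splittings
  \<open>\<gamma> = \<alpha> @ \<beta>\<close>. Stripping the first letter is also how
  \<open>comp_coeff\<close> and \<open>homog_part_Suc\<close> proceed, so the recursions fit
  together.\<close>

primrec conv :: "('n list \<Rightarrow> complex) \<Rightarrow> ('n list \<Rightarrow> complex) \<Rightarrow> 'n list \<Rightarrow> complex" where
  "conv a b [] = a [] * b []"
| "conv a b (i # \<gamma>) = a [] * b (i # \<gamma>) + conv (\<lambda>\<alpha>. a (i # \<alpha>)) b \<gamma>"

lemma conv_add_right: "conv a (\<lambda>\<beta>. b \<beta> + c \<beta>) \<gamma> = conv a b \<gamma> + conv a c \<gamma>"
  by (induction \<gamma> arbitrary: a) (simp_all add: distrib_left)

lemma conv_scale_right: "conv a (\<lambda>\<beta>. k * b \<beta>) \<gamma> = k * conv a b \<gamma>"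
  by (induction \<gamma> arbitrary: a) (simp_all add: distrib_left)

lemma conv_zero_right [simp]: "conv a (\<lambda>\<beta>. 0) \<gamma> = 0"
  by (induction \<gamma> arbitrary: a) simp_all

lemma conv_zero_left [simp]: "conv (\<lambda>\<alpha>. 0) b \<gamma> = 0"
  by (induction \<gamma>) simp_all

lemma conv_add_left: "conv (\<lambda>\<beta>. a \<beta> + b \<beta>) c \<gamma> = conv a c \<gamma> + conv b c \<gamma>"
  by (induction \<gamma> arbitrary: a b) (simp_all add: algebra_simps)

lemma conv_scale_left: "conv (\<lambda>\<beta>. k * a \<beta>) b \<gamma> = k * conv a b \<gamma>"
  by (induction \<gamma> arbitrary: a) (simp_all add: algebra_simps)

lemma conv_tendsto_left:
  "(\<And>\<alpha>. (\<lambda>n. f n \<alpha>) \<longlonglongrightarrow> a \<alpha>) \<Longrightarrow> (\<lambda>n. conv (f n) b \<gamma>) \<longlonglongrightarrow> conv a b \<gamma>"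
  by (induction \<gamma> arbitrary: f a) (simp_all add: tendsto_intros)

lemma conv_sum_left: "conv (\<lambda>\<beta>. \<Sum>k\<in>I. a k \<beta>) c \<gamma> = (\<Sum>k\<in>I. conv (a k) c \<gamma>)"
  by (induction I rule: infinite_finite_induct) (simp_all add: conv_add_left)

lemma conv_diff_right: "conv a (\<lambda>\<beta>. b \<beta> - c \<beta>) \<gamma> = conv a b \<gamma> - conv a c \<gamma>"
  using conv_add_right[of a b "\<lambda>\<beta>. - 1 * c \<beta>" \<gamma>] conv_scale_right[of a "-1" c \<gamma>] by simp

lemma conv_monomial_Nil: "conv a (monomial []) \<gamma> = a \<gamma>"
  by (induction \<gamma> arbitrary: a) (simp_all add: monomial_def)

lemma conv_cong_left:
  "(\<And>\<alpha>. length \<alpha> \<le> length \<gamma> \<Longrightarrow> a \<alpha> = a' \<alpha>) \<Longrightarrow> conv a b \<gamma> = conv a' b \<gamma>"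
proof (induction \<gamma> arbitrary: a a')
  case (Cons i \<gamma>)
  have "conv (\<lambda>\<alpha>. a (i # \<alpha>)) b \<gamma> = conv (\<lambda>\<alpha>. a' (i # \<alpha>)) b \<gamma>"
    by (rule Cons.IH) (simp add: Cons.prems)
  then show ?case
    using Cons.prems[of "[]"] by simp
qed simp

text \<open>The constant meets \<open>h\<close> only at the empty word, so the cross term involves
  \<open>h []\<close> alone. This is the orthogonality behind Littlewood's induction.\<close>

lemma trunc_sq_add_constant:
  fixes h :: "'n::finite list \<Rightarrow> complex"
  shows "trunc_sq d (\<lambda>\<gamma>. c * monomial [] \<gamma> + h \<gamma>) = trunc_sq d h + (cmod c)\<^sup>2 + 2 * Re (cnj c * h [])"
proof -
  have split: "trunc_sq d g = (cmod (g []))\<^sup>2 + (\<Sum>\<alpha>\<in>{\<alpha>. length \<alpha> \<le> d} - {[]}. (cmod (g \<alpha>))\<^sup>2)" for g :: "'n list \<Rightarrow> complex"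
    unfolding trunc_sq_def by (rule sum.remove) auto
  have "(\<Sum>\<alpha>\<in>{\<alpha>. length \<alpha> \<le> d} - {[]}. (cmod (c * monomial [] \<alpha> + h \<alpha>))\<^sup>2)
      = (\<Sum>\<alpha>\<in>{\<alpha>. length \<alpha> \<le> d} - {[]}. (cmod (h \<alpha>))\<^sup>2)"
    by (rule sum.cong) (auto simp: monomial_def)
  moreover have "(cmod (c + h []))\<^sup>2 = (cmod (h []))\<^sup>2 + (cmod c)\<^sup>2 + 2 * Re (cnj c * h [])"
    unfolding cmod_power2 by (simp add: power2_eq_square algebra_simps)
  moreover have "c * monomial [] ([] :: 'n list) = c"
    by (simp add: monomial_def)
  ultimately show ?thesis
    unfolding split[of h] split[of "\<lambda>\<gamma>. c * monomial [] \<gamma> + h \<gamma>"] by (simp only: add_ac)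
qed

lemma trunc_norm_constant: "trunc_norm d (\<lambda>\<gamma> :: 'n::finite list. c * monomial [] \<gamma>) = cmod c"
proof -
  have "trunc_sq d (\<lambda>\<gamma> :: 'n list. c * monomial [] \<gamma>) = (cmod c)\<^sup>2"
    using trunc_sq_add_constant[of d c "\<lambda>\<gamma> :: 'n list. 0"] by (simp add: trunc_sq_def[of d "\<lambda>\<beta>. 0"])
  then show ?thesis
    by (simp add: trunc_norm_def)
qed

definition trunc :: "nat \<Rightarrow> ('n list \<Rightarrow> complex) \<Rightarrow> 'n list \<Rightarrow> complex" where
  "trunc d a \<alpha> = (if length \<alpha> \<le> d then a \<alpha> else 0)"

text \<open>\<open>comp_coeff p d a\<close> consists of the coefficients of \<open>\<Sum> a\<^sub>\<alpha> p\<^sub>\<alpha>\<close>, the sum over the words of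
  length at most \<open>d\<close>.\<close>

primrec comp_coeff ::
  "('n::finite \<Rightarrow> 'n list \<Rightarrow> complex) \<Rightarrow> nat \<Rightarrow> ('n list \<Rightarrow> complex) \<Rightarrow> 'n list \<Rightarrow> complex" where
  "comp_coeff p 0 a = (\<lambda>\<gamma>. a [] * monomial [] \<gamma>)"
| "comp_coeff p (Suc d) a =
    (\<lambda>\<gamma>. a [] * monomial [] \<gamma> + (\<Sum>i\<in>UNIV. conv (p i) (comp_coeff p d (\<lambda>\<alpha>. a (i # \<alpha>))) \<gamma>))"

section \<open>Linearity and truncation of formal composition\<close>

lemma comp_coeff_add:
  "comp_coeff p d (\<lambda>\<alpha>. a \<alpha> + b \<alpha>) = (\<lambda>\<gamma>. comp_coeff p d a \<gamma> + comp_coeff p d b \<gamma>)"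
proof (induction d arbitrary: a b)
  case (Suc d)
  show ?case
    by (simp add: Suc conv_add_right sum.distrib distrib_right add_ac)
qed (simp add: distrib_right)

lemma comp_coeff_scale:
  "comp_coeff p d (\<lambda>\<alpha>. c * a \<alpha>) = (\<lambda>\<gamma>. c * comp_coeff p d a \<gamma>)"
proof (induction d arbitrary: a)
  case (Suc d)
  show ?case
    by (simp add: Suc conv_scale_right sum_distrib_left distrib_left mult.assoc)
qed (simp add: mult.assoc)

lemma comp_coeff_zero [simp]: "comp_coeff p d (\<lambda>\<alpha>. 0) = (\<lambda>\<gamma>. 0)"
  by (induction d) simp_all

lemma comp_coeff_diff:
  "comp_coeff p d (\<lambda>\<alpha>. a \<alpha> - b \<alpha>) = (\<lambda>\<gamma>. comp_coeff p d a \<gamma> - comp_coeff p d b \<gamma>)"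
  using comp_coeff_add[of p d a "\<lambda>\<alpha>. -1 * b \<alpha>"] comp_coeff_scale[of p d "-1" b] by simp

lemma comp_coeff_sum:
  "comp_coeff p d (\<lambda>\<alpha>. \<Sum>i\<in>I. a i \<alpha>) = (\<lambda>\<gamma>. \<Sum>i\<in>I. comp_coeff p d (a i) \<gamma>)"
  by (induction I rule: infinite_finite_induct) (simp_all add: comp_coeff_add)

text \<open>Deleted words contribute nothing, so extra depth is harmless. Composites at two depths
  can therefore be compared by linearity at the larger one.\<close>

lemma comp_coeff_trunc: "comp_coeff p (m + j) (trunc m a) = comp_coeff p m a"
proof (induction m arbitrary: a)
  case 0
  show ?case
    by (cases j) (simp_all add: trunc_def)
next
  case (Suc m)
  have "(\<lambda>\<alpha>. trunc (Suc m) a (i # \<alpha>)) = trunc m (\<lambda>\<alpha>. a (i # \<alpha>))" for i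
    by (simp add: trunc_def fun_eq_iff)
  with Suc show ?case
    by (simp add: trunc_def[of _ _ "[]"])
qed

lemma comp_coeff_constant: "comp_coeff p d (monomial []) = monomial []"
  by (cases d) (simp_all add: fun_eq_iff monomial_def[of "[]" "[]"] monomial_def[of "[]" "_ # _"])

lemma comp_coeff_monomial: "length \<alpha> \<le> d \<Longrightarrow> comp_coeff p d (monomial \<alpha>) = comp_coeff p (length \<alpha>) (monomial \<alpha>)"
proof -
  assume "length \<alpha> \<le> d"
  moreover have "trunc (length \<alpha>) (monomial \<alpha>) = monomial \<alpha>"
    by (auto simp: trunc_def monomial_def fun_eq_iff)
  ultimately show ?thesis
    using comp_coeff_trunc[of p "length \<alpha>" "d - length \<alpha>" "monomial \<alpha>"] by simp
qed

lemma comp_coeff_expand: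
  "comp_coeff p d a \<gamma> = (\<Sum>\<alpha> | length \<alpha> \<le> d. a \<alpha> * comp_coeff p (length \<alpha>) (monomial \<alpha>) \<gamma>)"
proof -
  have "trunc d a = (\<lambda>\<gamma>. \<Sum>\<alpha> | length \<alpha> \<le> d. a \<alpha> * monomial \<alpha> \<gamma>)"
    by (auto simp: trunc_def monomial_def fun_eq_iff if_distrib cong: if_cong)
  then have "comp_coeff p d a = comp_coeff p d (\<lambda>\<gamma>. \<Sum>\<alpha> | length \<alpha> \<le> d. a \<alpha> * monomial \<alpha> \<gamma>)"
    using comp_coeff_trunc[of p d 0 a] by simp
  then have "comp_coeff p d a \<gamma> = (\<Sum>\<alpha> | length \<alpha> \<le> d. a \<alpha> * comp_coeff p d (monomial \<alpha>) \<gamma>)"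
    by (simp add: comp_coeff_sum comp_coeff_scale)
  also have "\<dots> = (\<Sum>\<alpha> | length \<alpha> \<le> d. a \<alpha> * comp_coeff p (length \<alpha>) (monomial \<alpha>) \<gamma>)"
    by (intro sum.cong refl arg_cong2[where f = "(*)"] fun_cong[OF comp_coeff_monomial]) simp
  finally show ?thesis .
qed

text \<open>Coefficients of the product with a linear form on the right. On this side the new letter
  lands at the end of a word, whereas \<open>comp_coeff\<close> strips letters from the front, so
  the operation passes to the tails (\<open>right_mult_Cons\<close>).\<close>

definition right_mult :: "('n \<Rightarrow> complex) \<Rightarrow> ('n list \<Rightarrow> complex) \<Rightarrow> 'n list \<Rightarrow> complex" where
  "right_mult l a \<gamma> = (if \<gamma> = [] then 0 else a (butlast \<gamma>) * l (last \<gamma>))"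

lemma right_mult_Nil [simp]: "right_mult l a [] = 0"
  by (simp add: right_mult_def)

lemma right_mult_Cons:
  "(\<lambda>\<gamma>. right_mult l a (i # \<gamma>)) = (\<lambda>\<gamma>. a [] * l i * monomial [] \<gamma> + right_mult l (\<lambda>\<alpha>. a (i # \<alpha>)) \<gamma>)"
  by (auto simp: right_mult_def monomial_def)

text \<open>A nonempty word is determined by its \<open>butlast\<close> and \<open>last\<close>, so
  the norm factors exactly, at a degree one higher. In the induction the cross terms vanish because
  \<open>right_mult\<close> has no constant term.\<close>

lemma trunc_sq_right_mult:
  "trunc_sq (Suc d) (right_mult l a) = (\<Sum>i\<in>UNIV. (cmod (l i))\<^sup>2) * trunc_sq d a"
proof (induction d arbitrary: a)
  case 0
  show ?case
    by (simp add: trunc_sq_Suc right_mult_def norm_mult power_mult_distrib sum_distrib_left mult.commute)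
next
  case (Suc d)
  show ?case
    unfolding trunc_sq_Suc[of "Suc d"] right_mult_Cons trunc_sq_add_constant Suc
    by (simp add: sum.distrib trunc_sq_Suc[of d a] norm_mult power_mult_distrib distrib_left
        mult.commute flip: sum_distrib_left sum_distrib_right)
qed

text \<open>What composition needs from \<phi>, in terms of coefficients. The contraction is
  required at every truncation level and so makes sense for arbitrary families \<open>y\<close>;
  strictness at the constant terms makes the later geometric series converge.\<close>

locale formal_self_map =
  fixes p :: "'n::finite \<Rightarrow> 'n list \<Rightarrow> complex"
  assumes row_contraction:
      "trunc_sq N (\<lambda>\<gamma>. \<Sum>i\<in>UNIV. conv (p i) (y i) \<gamma>) \<le> (\<Sum>i\<in>UNIV. trunc_sq N (y i))"
    and constants: "(\<Sum>i\<in>UNIV. (cmod (p i []))\<^sup>2) < 1"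
begin

definition r0 :: real where
  "r0 = sqrt (\<Sum>i\<in>UNIV. (cmod (p i []))\<^sup>2)"

lemma r0: "0 \<le> r0" "r0 < 1" "r0\<^sup>2 = (\<Sum>i\<in>UNIV. (cmod (p i []))\<^sup>2)"
  using constants by (simp_all add: r0_def sum_nonneg)

abbreviation mult_const :: "('n list \<Rightarrow> complex) \<Rightarrow> 'n list \<Rightarrow> complex" where
  "mult_const \<equiv> right_mult (\<lambda>i. cnj (p i []))"

lemma trunc_norm_mult_const: "trunc_norm (Suc d) (mult_const a) = r0 * trunc_norm d a"
  unfolding trunc_norm_def trunc_sq_right_mult by (simp add: real_sqrt_mult r0_def)

text \<open>Littlewood subordination: the constant term is orthogonal to the rest up to a correction by
  the constant terms of the \<open>p i\<close>, which the factor \<open>1 - \<Sum> cnj (p i []) p i\<close> absorbs.\<close>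

lemma trunc_sq_comp_step:
  "trunc_sq N (\<lambda>\<gamma>. c * monomial [] \<gamma> + (\<Sum>i\<in>UNIV. conv (p i) (\<lambda>\<beta>. x i \<beta> - c * cnj (p i []) * monomial [] \<beta>) \<gamma>))
    \<le> (1 - r0\<^sup>2) * (cmod c)\<^sup>2 + (\<Sum>i\<in>UNIV. trunc_sq N (x i))"
proof -
  define y where "y i \<beta> = - (c * cnj (p i [])) * monomial [] \<beta> + x i \<beta>" for i \<beta>
  define h where "h \<gamma> = (\<Sum>i\<in>UNIV. conv (p i) (y i) \<gamma>)" for \<gamma>
  define s where "s = (\<Sum>i\<in>UNIV. Re (cnj c * p i [] * x i []))"
  have "trunc_sq N (y i) = trunc_sq N (x i) + (cmod c)\<^sup>2 * (cmod (p i []))\<^sup>2 - 2 * Re (cnj c * p i [] * x i [])" for i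
    unfolding y_def trunc_sq_add_constant
    by (simp add: norm_mult power_mult_distrib)
  then have 1: "(\<Sum>i\<in>UNIV. trunc_sq N (y i)) = (\<Sum>i\<in>UNIV. trunc_sq N (x i)) + (cmod c)\<^sup>2 * r0\<^sup>2 - 2 * s"
    by (simp only: r0(3) s_def sum_subtractf sum.distrib sum_distrib_left)
  have "cnj c * h [] = (\<Sum>i\<in>UNIV. cnj c * p i [] * x i [] - (cnj c * c) * (p i [] * cnj (p i [])))"
    by (simp add: h_def y_def monomial_def sum_distrib_left algebra_simps)
  then have "cnj c * h [] = (\<Sum>i\<in>UNIV. cnj c * p i [] * x i []) - complex_of_real ((cmod c)\<^sup>2 * r0\<^sup>2)"
    unfolding r0(3)
    by (simp add: sum_subtractf sum_distrib_left complex_norm_square mult.commute del: of_real_power)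
  then have 2: "Re (cnj c * h []) = s - (cmod c)\<^sup>2 * r0\<^sup>2"
    by (simp only: minus_complex.sel Re_complex_of_real s_def Re_sum)
  have "trunc_sq N h \<le> (\<Sum>i\<in>UNIV. trunc_sq N (y i))"
    unfolding h_def by (rule row_contraction)
  \<comment> \<open>The terms \<open>2 * s\<close> cancel, and the contributions
    \<open>r0\<^sup>2 - 2 * r0\<^sup>2\<close> turn the coefficient of
    \<open>(cmod c)\<^sup>2\<close> into \<open>1 - r0\<^sup>2\<close>.\<close>
  then have "trunc_sq N (\<lambda>\<gamma>. c * monomial [] \<gamma> + h \<gamma>) \<le> (1 - r0\<^sup>2) * (cmod c)\<^sup>2 + (\<Sum>i\<in>UNIV. trunc_sq N (x i))"
    unfolding trunc_sq_add_constant 1 2 by (simp add: algebra_simps)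
  moreover have "y i = (\<lambda>\<beta>. x i \<beta> - c * cnj (p i []) * monomial [] \<beta>)" for i
    by (simp add: y_def fun_eq_iff)
  ultimately show ?thesis
    by (simp add: h_def)
qed

text \<open>The recursion for A in the shape of \<open>trunc_sq_comp_step\<close>, with
  \<open>x i\<close> equal to A of the i-th tail. The product with the linear form is composed at a
  depth one higher because its degree is one higher.\<close>

lemma comp_coeff_mult_const:
  "comp_coeff p (Suc d) a \<gamma> - comp_coeff p (Suc (Suc d)) (mult_const a) \<gamma>
    = a [] * monomial [] \<gamma> + (\<Sum>i\<in>UNIV. conv (p i) (\<lambda>\<beta>. (comp_coeff p d (\<lambda>\<alpha>. a (i # \<alpha>)) \<beta>
        - comp_coeff p (Suc d) (mult_const (\<lambda>\<alpha>. a (i # \<alpha>))) \<beta>)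
        - a [] * cnj (p i []) * monomial [] \<beta>) \<gamma>)"
proof -
  \<comment> \<open>The one-letter words of \<open>mult_const a\<close> give each tail a constant
    term, while \<open>mult_const a\<close> itself has none.\<close>
  have "comp_coeff p (Suc (Suc d)) (mult_const a) \<gamma>
      = (\<Sum>i\<in>UNIV. conv (p i) (\<lambda>\<beta>. a [] * cnj (p i []) * monomial [] \<beta>
          + comp_coeff p (Suc d) (mult_const (\<lambda>\<alpha>. a (i # \<alpha>))) \<beta>) \<gamma>)"
    by (subst comp_coeff.simps(2), subst right_mult_Cons, subst comp_coeff_add, subst comp_coeff_scale,
        subst comp_coeff_constant) simp
  then show ?thesis
    by (simp add: conv_diff_right conv_add_right sum_subtractf sum.distrib del: comp_coeff.simps(2))
      (simp add: comp_coeff.simps(2)[of p d a])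
qed

lemma trunc_sq_comp_mult_const:
  "trunc_sq N (\<lambda>\<gamma>. comp_coeff p d a \<gamma> - comp_coeff p (Suc d) (mult_const a) \<gamma>) \<le> (1 - r0\<^sup>2) * trunc_sq d a"
proof (induction d arbitrary: a)
  case 0
  have "comp_coeff p 0 a \<gamma> - comp_coeff p (Suc 0) (mult_const a) \<gamma>
      = a [] * monomial [] \<gamma> + (\<Sum>i\<in>UNIV. conv (p i) (\<lambda>\<beta>. 0 - a [] * cnj (p i []) * monomial [] \<beta>) \<gamma>)" for \<gamma>
    unfolding conv_diff_right by (simp add: right_mult_def sum_negf)
  then have eq: "(\<lambda>\<gamma>. comp_coeff p 0 a \<gamma> - comp_coeff p (Suc 0) (mult_const a) \<gamma>)
      = (\<lambda>\<gamma>. a [] * monomial [] \<gamma> + (\<Sum>i\<in>UNIV. conv (p i) (\<lambda>\<beta>. 0 - a [] * cnj (p i []) * monomial [] \<beta>) \<gamma>))"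
    by blast
  show ?case
    unfolding eq using trunc_sq_comp_step[of N "a []" "\<lambda>i \<beta>. 0"] by (simp add: trunc_sq_def[of N "\<lambda>\<beta>. 0"])
next
  case (Suc d)
  have "trunc_sq N (\<lambda>\<gamma>. comp_coeff p (Suc d) a \<gamma> - comp_coeff p (Suc (Suc d)) (mult_const a) \<gamma>)
    \<le> (1 - r0\<^sup>2) * (cmod (a []))\<^sup>2 + (\<Sum>i\<in>UNIV. (1 - r0\<^sup>2) * trunc_sq d (\<lambda>\<alpha>. a (i # \<alpha>)))"
    unfolding comp_coeff_mult_const
    by (rule order_trans[OF trunc_sq_comp_step]) (intro add_left_mono sum_mono Suc)
  then show ?case
    by (simp add: trunc_sq_Suc sum_distrib_left distrib_left)
qed

text \<open>Dropping the factor \<open>1 - r0\<^sup>2\<close> leads to the final constant 1 / (1 -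
  r0); keeping its square root would give the classical square root of (1 + r0) / (1 - r0).\<close>

lemma trunc_norm_comp_mult_const:
  "trunc_norm N (\<lambda>\<gamma>. comp_coeff p d a \<gamma> - comp_coeff p (Suc d) (mult_const a) \<gamma>) \<le> trunc_norm d a"
proof -
  have "(1 - r0\<^sup>2) * trunc_sq d a \<le> 1 * trunc_sq d a"
    by (intro mult_right_mono) auto
  with trunc_sq_comp_mult_const[of N d a] show ?thesis
    by (simp add: trunc_norm_def)
qed

text \<open>One triangle inequality per degree, between the constant term and the contractive row.
  Only the polynomial growth in \<open>d\<close> matters.\<close>

lemma trunc_norm_comp_crude: "trunc_norm N (comp_coeff p d a) \<le> real (Suc d) * trunc_norm d a"
proof (induction d arbitrary: a)
  case 0
  show ?case
    by (simp add: trunc_norm_constant) (simp add: trunc_norm_def)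
next
  case (Suc d)
  define h where "h \<gamma> = (\<Sum>i\<in>UNIV. conv (p i) (comp_coeff p d (\<lambda>\<alpha>. a (i # \<alpha>))) \<gamma>)" for \<gamma>
  have "trunc_sq N h \<le> (\<Sum>i\<in>UNIV. trunc_sq N (comp_coeff p d (\<lambda>\<alpha>. a (i # \<alpha>))))"
    unfolding h_def by (rule row_contraction)
  also have "\<dots> \<le> (\<Sum>i\<in>UNIV. (real (Suc d))\<^sup>2 * trunc_sq d (\<lambda>\<alpha>. a (i # \<alpha>)))"
  proof (rule sum_mono)
    fix i
    have "(trunc_norm N (comp_coeff p d (\<lambda>\<alpha>. a (i # \<alpha>))))\<^sup>2 \<le> (real (Suc d) * trunc_norm d (\<lambda>\<alpha>. a (i # \<alpha>)))\<^sup>2"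
      by (intro power_mono Suc) simp
    then show "trunc_sq N (comp_coeff p d (\<lambda>\<alpha>. a (i # \<alpha>))) \<le> (real (Suc d))\<^sup>2 * trunc_sq d (\<lambda>\<alpha>. a (i # \<alpha>))"
      by (simp only: power_mult_distrib trunc_norm_sq)
  qed
  also have "\<dots> \<le> (real (Suc d))\<^sup>2 * trunc_sq (Suc d) a"
    by (simp add: trunc_sq_Suc sum_distrib_left[symmetric] mult_left_mono)
  finally have "(trunc_norm N h)\<^sup>2 \<le> (real (Suc d) * trunc_norm (Suc d) a)\<^sup>2"
    by (simp only: power_mult_distrib trunc_norm_sq)
  then have h: "trunc_norm N h \<le> real (Suc d) * trunc_norm (Suc d) a"
    by (rule power2_le_imp_le) simp
  have "comp_coeff p (Suc d) a = (\<lambda>\<gamma>. a [] * monomial [] \<gamma> + h \<gamma>)"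
    by (simp add: h_def)
  then have "trunc_norm N (comp_coeff p (Suc d) a) \<le> cmod (a []) + trunc_norm N h"
    using trunc_norm_triangle[of N "\<lambda>\<gamma>. a [] * monomial [] \<gamma>" h]
    by (simp only: trunc_norm_constant)
  also have "\<dots> \<le> trunc_norm (Suc d) a + real (Suc d) * trunc_norm (Suc d) a"
    by (intro add_mono h cmod_le_trunc_norm) simp
  also have "\<dots> = real (Suc (Suc d)) * trunc_norm (Suc d) a"
    by (simp add: algebra_simps)
  finally show ?case .
qed

text \<open>Each round splits off A and leaves the composite of \<open>mult_const a\<close>, whose
  degree is one higher and whose norm is smaller by the factor \<open>r0\<close>. After J rounds the
  crude bound is applied at degree d + J.\<close>

lemma trunc_norm_comp_iterate:
  "trunc_norm N (comp_coeff p d a)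
    \<le> ((\<Sum>j<J. r0 ^ j) + real (Suc (d + J)) * r0 ^ J) * trunc_norm d a"
proof (induction J arbitrary: d a)
  case 0
  show ?case
    using trunc_norm_comp_crude[of N d a] by simp
next
  case (Suc J)
  have "trunc_norm N (comp_coeff p d a)
      \<le> trunc_norm N (\<lambda>\<gamma>. comp_coeff p d a \<gamma> - comp_coeff p (Suc d) (mult_const a) \<gamma>)
        + trunc_norm N (comp_coeff p (Suc d) (mult_const a))"
    using trunc_norm_triangle[of N "\<lambda>\<gamma>. comp_coeff p d a \<gamma> - comp_coeff p (Suc d) (mult_const a) \<gamma>"
        "comp_coeff p (Suc d) (mult_const a)"] by simp
  also have "\<dots> \<le> trunc_norm d a
      + ((\<Sum>j<J. r0 ^ j) + real (Suc (Suc d + J)) * r0 ^ J) * (r0 * trunc_norm d a)"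
    using trunc_norm_comp_mult_const[of N d a] Suc[of "Suc d" "mult_const a"]
    unfolding trunc_norm_mult_const by linarith
  also have "\<dots> = (1 + r0 * (\<Sum>j<J. r0 ^ j) + real (Suc (d + Suc J)) * r0 ^ Suc J) * trunc_norm d a"
    by (simp add: algebra_simps)
  also have "1 + r0 * (\<Sum>j<J. r0 ^ j) = (\<Sum>j<Suc J. r0 ^ j)"
    by (simp only: sum.lessThan_Suc_shift sum_distrib_left power_Suc power_0)
  finally show ?case .
qed

lemma trunc_norm_comp: "trunc_norm N (comp_coeff p d a) \<le> trunc_norm d a / (1 - r0)"
proof -
  \<comment> \<open>Linear growth of the remainder in J is beaten by the geometric factor.\<close>
  have "(\<lambda>J. real J * r0 ^ J) \<longlonglongrightarrow> 0" "(\<lambda>J. r0 ^ J) \<longlonglongrightarrow> 0"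
    using r0(1,2) by (auto intro!: powser_times_n_limit_0 LIMSEQ_power_zero)
  then have t2: "(\<lambda>J. real J * r0 ^ J + real (Suc d) * r0 ^ J) \<longlonglongrightarrow> 0 + real (Suc d) * 0"
    by (intro tendsto_add tendsto_mult tendsto_const)
  have t1: "(\<lambda>J. (\<Sum>j<J. r0 ^ j)) \<longlonglongrightarrow> 1 / (1 - r0)"
    using geometric_sums[of r0] r0 by (simp add: sums_def)
  have "(\<lambda>J. ((\<Sum>j<J. r0 ^ j) + (real J * r0 ^ J + real (Suc d) * r0 ^ J)) * trunc_norm d a)
      \<longlonglongrightarrow> (1 / (1 - r0) + (0 + real (Suc d) * 0)) * trunc_norm d a"
    by (rule tendsto_mult[OF tendsto_add[OF t1 t2] tendsto_const])
  then have "trunc_norm N (comp_coeff p d a) \<le> (1 / (1 - r0) + (0 + real (Suc d) * 0)) * trunc_norm d a"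
  proof (rule tendsto_lowerbound)
    show "\<forall>\<^sub>F J in sequentially. trunc_norm N (comp_coeff p d a)
        \<le> ((\<Sum>j<J. r0 ^ j) + (real J * r0 ^ J + real (Suc d) * r0 ^ J)) * trunc_norm d a"
      using trunc_norm_comp_iterate[of N d a] by (intro always_eventually) (simp add: algebra_simps)
  qed simp
  then show ?thesis by simp
qed

end

section \<open>Composition on square summable families\<close>

lemma ell2_monomial: "ell2 (monomial \<alpha> :: 'n::finite list \<Rightarrow> complex)"
proof (rule ell2I)
  have "(cmod (monomial \<alpha> \<gamma>))\<^sup>2 = (if \<gamma> = \<alpha> then 1 else 0)" for \<gamma>
    by (simp add: monomial_def)
  then show "trunc_sq d (monomial \<alpha>) \<le> 1" for d
    by (simp add: trunc_sq_def)
qed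

lemma ell2_zero: "ell2 (\<lambda>\<alpha>. 0)"
  by (simp add: ell2_def)

lemma ell2_inner_monomial_left: "ell2_inner (monomial \<alpha>) b = cnj (b \<alpha>)"
proof -
  have "ell2_inner (monomial \<alpha>) b = (\<Sum>\<^sub>\<infinity>\<gamma>\<in>{\<alpha>}. monomial \<alpha> \<gamma> * cnj (b \<gamma>))"
    unfolding ell2_inner_def by (rule infsum_cong_neutral) (auto simp: monomial_def)
  then show ?thesis
    by (simp add: monomial_def)
qed

context formal_self_map
begin

definition comp_limit :: "('n list \<Rightarrow> complex) \<Rightarrow> 'n list \<Rightarrow> complex" where
  "comp_limit a \<gamma> = lim (\<lambda>d. comp_coeff p d a \<gamma>)"

lemma ell2_conv:
  assumes "ell2 b"
  shows "ell2 (conv (p i) b)"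
proof (rule ell2I)
  fix d
  \<comment> \<open>A row with a single nonzero entry: each component is by itself a contractive
    left multiplier.\<close>
  define y where "y j = (if j = i then b else (\<lambda>\<beta>. 0))" for j
  have "conv (p j) (y j) \<gamma> = (if j = i then conv (p i) b \<gamma> else 0)" for j \<gamma>
    by (simp add: y_def)
  moreover have "trunc_sq d (y j) = (if j = i then trunc_sq d b else 0)" for j
    by (simp add: y_def trunc_sq_def)
  ultimately have "trunc_sq d (conv (p i) b) \<le> trunc_sq d b"
    using row_contraction[of d y] by simp
  also have "\<dots> \<le> ell2_sq b"
    by (rule trunc_sq_le_ell2_sq[OF assms])
  finally show "trunc_sq d (conv (p i) b) \<le> ell2_sq b" .
qed

lemma ell2_p: "ell2 (p i)"
proof -
  have "conv (p i) (monomial []) = p i"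
    by (rule ext) (rule conv_monomial_Nil)
  with ell2_conv[OF ell2_monomial, of i "[]"] show ?thesis by simp
qed

lemma ell2_comp_coeff: "ell2 (comp_coeff p d a)"
proof (rule ell2I)
  show "trunc_sq N (comp_coeff p d a) \<le> (trunc_norm d a / (1 - r0))\<^sup>2" for N
    using power_mono[OF trunc_norm_comp[of N d a] trunc_norm_nonneg, of 2] by (simp only: trunc_norm_sq)
qed

text \<open>The square root is the norm of the part of \<open>a\<close> in degrees above
  \<open>m\<close>, and 1 / (1 - r0) is the bound for composition.\<close>

definition tail_bound :: "('n list \<Rightarrow> complex) \<Rightarrow> nat \<Rightarrow> real" where
  "tail_bound a m = sqrt (ell2_sq a - trunc_sq m a) / (1 - r0)"

lemma trunc_norm_comp_tail:
  assumes "ell2 a" "m \<le> d"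
  shows "trunc_norm N (\<lambda>\<gamma>. comp_coeff p d a \<gamma> - comp_coeff p m a \<gamma>) \<le> tail_bound a m"
proof -
  have "comp_coeff p m a = comp_coeff p d (trunc m a)"
    using comp_coeff_trunc[of p m "d - m" a] assms(2) by simp
  then have "(\<lambda>\<gamma>. comp_coeff p d a \<gamma> - comp_coeff p m a \<gamma>) = comp_coeff p d (\<lambda>\<alpha>. a \<alpha> - trunc m a \<alpha>)"
    by (simp add: comp_coeff_diff)
  then have 1: "trunc_norm N (\<lambda>\<gamma>. comp_coeff p d a \<gamma> - comp_coeff p m a \<gamma>)
      \<le> trunc_norm d (\<lambda>\<alpha>. a \<alpha> - trunc m a \<alpha>) / (1 - r0)"
    using trunc_norm_comp[of N d "\<lambda>\<alpha>. a \<alpha> - trunc m a \<alpha>"] by simp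
  have sub: "{\<alpha> :: 'n list. length \<alpha> \<le> m} \<subseteq> {\<alpha>. length \<alpha> \<le> d}"
    using assms(2) by auto
  have "trunc_sq d (\<lambda>\<alpha>. a \<alpha> - trunc m a \<alpha>)
      = (\<Sum>\<alpha>\<in>{\<alpha>. length \<alpha> \<le> d} - {\<alpha>. length \<alpha> \<le> m}. (cmod (a \<alpha> - trunc m a \<alpha>))\<^sup>2)"
    unfolding trunc_sq_def by (rule sum.mono_neutral_right) (auto simp: trunc_def)
  also have "\<dots> = (\<Sum>\<alpha>\<in>{\<alpha>. length \<alpha> \<le> d} - {\<alpha>. length \<alpha> \<le> m}. (cmod (a \<alpha>))\<^sup>2)"
    by (rule sum.cong) (auto simp: trunc_def)
  also have "\<dots> = trunc_sq d a - trunc_sq m a"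
    unfolding trunc_sq_def by (rule sum_diff[OF finite_length_le sub])
  also have "\<dots> \<le> ell2_sq a - trunc_sq m a"
    using trunc_sq_le_ell2_sq[OF assms(1), of d] by simp
  finally have "trunc_norm d (\<lambda>\<alpha>. a \<alpha> - trunc m a \<alpha>) \<le> sqrt (ell2_sq a - trunc_sq m a)"
    by (simp add: trunc_norm_def)
  then have "trunc_norm d (\<lambda>\<alpha>. a \<alpha> - trunc m a \<alpha>) / (1 - r0) \<le> tail_bound a m"
    unfolding tail_bound_def using r0(2) by (simp add: divide_right_mono)
  with 1 show ?thesis by linarith
qed

lemma tail_bound_tendsto:
  assumes "ell2 a"
  shows "tail_bound a \<longlonglongrightarrow> 0"
proof -
  have "(\<lambda>m. sqrt (ell2_sq a - trunc_sq m a) / (1 - r0)) \<longlonglongrightarrow> sqrt (ell2_sq a - ell2_sq a) / (1 - r0)"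
    using r0(2) by (intro tendsto_intros trunc_sq_tendsto assms) auto
  then show ?thesis
    by (simp add: tail_bound_def[abs_def])
qed

lemma comp_limit_tendsto:
  assumes "ell2 a"
  shows "(\<lambda>d. comp_coeff p d a \<gamma>) \<longlonglongrightarrow> comp_limit a \<gamma>"
proof -
  have "Cauchy (\<lambda>d. comp_coeff p d a \<gamma>)"
  proof (rule CauchyI')
    fix e :: real assume "0 < e"
    then obtain M where M: "\<And>m. m \<ge> M \<Longrightarrow> norm (tail_bound a m - 0) < e"
      using LIMSEQ_D[OF tail_bound_tendsto[OF assms]] by blast
    have "norm (comp_coeff p m a \<gamma> - comp_coeff p d a \<gamma>) < e" if "m \<ge> M" "d > m" for m d
    proof -
      have "norm (comp_coeff p d a \<gamma> - comp_coeff p m a \<gamma>)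
          \<le> trunc_norm (length \<gamma>) (\<lambda>\<gamma>. comp_coeff p d a \<gamma> - comp_coeff p m a \<gamma>)"
        by (rule cmod_le_trunc_norm[of _ _ "\<lambda>\<gamma>. comp_coeff p d a \<gamma> - comp_coeff p m a \<gamma>"]) simp
      also have "\<dots> \<le> tail_bound a m"
        using that by (intro trunc_norm_comp_tail assms) simp
      also have "\<dots> < e"
        using M[OF that(1)] by simp
      finally show ?thesis
        by (simp add: norm_minus_commute)
    qed
    then show "\<exists>M. \<forall>m\<ge>M. \<forall>n>m. dist (comp_coeff p m a \<gamma>) (comp_coeff p n a \<gamma>) < e"
      unfolding dist_norm by blast
  qed
  then show ?thesis
    unfolding comp_limit_def using Cauchy_convergent convergent_LIMSEQ_iff by blast
qed

lemma trunc_norm_tendsto: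
  assumes "\<And>\<gamma>. (\<lambda>d. f d \<gamma>) \<longlonglongrightarrow> g \<gamma>"
  shows "(\<lambda>d. trunc_norm N (f d)) \<longlonglongrightarrow> trunc_norm N g"
  unfolding trunc_norm_def trunc_sq_def by (intro tendsto_intros assms)

lemma trunc_norm_comp_limit_tail:
  assumes "ell2 a"
  shows "trunc_norm N (\<lambda>\<gamma>. comp_limit a \<gamma> - comp_coeff p m a \<gamma>) \<le> tail_bound a m"
proof (rule LIMSEQ_le_const2)
  show "(\<lambda>d. trunc_norm N (\<lambda>\<gamma>. comp_coeff p d a \<gamma> - comp_coeff p m a \<gamma>))
      \<longlonglongrightarrow> trunc_norm N (\<lambda>\<gamma>. comp_limit a \<gamma> - comp_coeff p m a \<gamma>)"
    by (intro trunc_norm_tendsto tendsto_intros comp_limit_tendsto assms)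
  show "\<exists>D. \<forall>d\<ge>D. trunc_norm N (\<lambda>\<gamma>. comp_coeff p d a \<gamma> - comp_coeff p m a \<gamma>) \<le> tail_bound a m"
    using trunc_norm_comp_tail[OF assms] by blast
qed

lemma comp_limit_bound:
  assumes "ell2 a"
  shows "ell2 (comp_limit a)" "ell2_sq (comp_limit a) \<le> (sqrt (ell2_sq a) / (1 - r0))\<^sup>2"
proof -
  have *: "trunc_norm N (comp_limit a) \<le> sqrt (ell2_sq a) / (1 - r0)" for N
  proof (rule LIMSEQ_le_const2)
    show "(\<lambda>d. trunc_norm N (comp_coeff p d a)) \<longlonglongrightarrow> trunc_norm N (comp_limit a)"
      by (intro trunc_norm_tendsto comp_limit_tendsto assms)
    have "trunc_norm N (comp_coeff p d a) \<le> sqrt (ell2_sq a) / (1 - r0)" for d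
      by (rule order_trans[OF trunc_norm_comp]) (use r0(2) in \<open>simp add: divide_right_mono trunc_norm_le assms\<close>)
    then show "\<exists>D. \<forall>d\<ge>D. trunc_norm N (comp_coeff p d a) \<le> sqrt (ell2_sq a) / (1 - r0)"
      by blast
  qed
  have "trunc_sq N (comp_limit a) \<le> (sqrt (ell2_sq a) / (1 - r0))\<^sup>2" for N
    using power_mono[OF * trunc_norm_nonneg, of N 2] by (simp only: trunc_norm_sq)
  from ell2I[of "comp_limit a", OF this]
  show "ell2 (comp_limit a)" "ell2_sq (comp_limit a) \<le> (sqrt (ell2_sq a) / (1 - r0))\<^sup>2" .
qed

lemma comp_limit_monomial: "comp_limit (monomial \<alpha>) = comp_coeff p (length \<alpha>) (monomial \<alpha>)"
proof
  fix \<gamma>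
  have "(\<lambda>d. comp_coeff p d (monomial \<alpha>) \<gamma>) \<longlonglongrightarrow> comp_coeff p (length \<alpha>) (monomial \<alpha>) \<gamma>"
    by (rule tendsto_eventually, rule eventually_sequentiallyI[of "length \<alpha>"])
      (rule fun_cong[OF comp_coeff_monomial])
  then show "comp_limit (monomial \<alpha>) \<gamma> = comp_coeff p (length \<alpha>) (monomial \<alpha>) \<gamma>"
    using comp_limit_tendsto[OF ell2_monomial] LIMSEQ_unique by blast
qed

lemma comp_limit_tail:
  assumes a: "ell2 a"
  shows "ell2 (\<lambda>\<gamma>. comp_limit a \<gamma> - comp_coeff p d a \<gamma>)"
    and "sqrt (ell2_sq (\<lambda>\<gamma>. comp_limit a \<gamma> - comp_coeff p d a \<gamma>)) \<le> tail_bound a d"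
proof -
  define h where "h \<gamma> = comp_limit a \<gamma> - comp_coeff p d a \<gamma>" for \<gamma>
  have tail: "trunc_norm N h \<le> tail_bound a d" for N
    using trunc_norm_comp_limit_tail[OF a] by (simp only: h_def[abs_def])
  have "trunc_sq N h \<le> (tail_bound a d)\<^sup>2" for N
    using power_mono[OF tail trunc_norm_nonneg, of N 2] by (simp only: trunc_norm_sq)
  note h = ell2I[of h, OF this]
  have "0 \<le> tail_bound a d"
    by (rule order_trans[OF trunc_norm_nonneg tail[of 0]])
  with h show "ell2 (\<lambda>\<gamma>. comp_limit a \<gamma> - comp_coeff p d a \<gamma>)"
    and "sqrt (ell2_sq (\<lambda>\<gamma>. comp_limit a \<gamma> - comp_coeff p d a \<gamma>)) \<le> tail_bound a d"
    unfolding h_def[abs_def] by (auto intro!: real_le_lsqrt)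
qed

text \<open>The coefficients claimed by the theorem: \<open>comp_limit (monomial \<alpha>)\<close>
  is the coefficient family of the product of the components of \<phi> along \<alpha>
  (\<open>free_coeff_map_word\<close>). It remains to verify that they define an adjoint.\<close>

definition comp_adjoint :: "('n list \<Rightarrow> complex) \<Rightarrow> 'n list \<Rightarrow> complex" where
  "comp_adjoint g \<alpha> = ell2_inner g (comp_limit (monomial \<alpha>))"

lemma ell2_inner_comp_coeff:
  assumes "ell2 g"
  shows "ell2_inner (comp_coeff p d a) g = (\<Sum>\<alpha> | length \<alpha> \<le> d. a \<alpha> * cnj (comp_adjoint g \<alpha>))"
proof -
  have "comp_coeff p d a = (\<lambda>\<gamma>. \<Sum>\<alpha> | length \<alpha> \<le> d. a \<alpha> * comp_limit (monomial \<alpha>) \<gamma>)"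
    by (rule ext) (simp only: comp_limit_monomial comp_coeff_expand[of p d a])
  then show ?thesis
    by (simp add: ell2_inner_sum_left ell2_inner_scale_left ell2_scale comp_limit_bound ell2_monomial
        assms comp_adjoint_def flip: ell2_inner_commute)
qed

text \<open>Duality: the composite of the polynomial whose coefficients are those of
  \<open>comp_adjoint g\<close> up to degree \<open>d\<close>, paired with \<open>g\<close>, gives
  \<open>trunc_sq d (comp_adjoint g)\<close>. The bound for composition leaves one factor
  \<open>trunc_norm\<close> to cancel.\<close>

lemma comp_adjoint_bound:
  assumes "ell2 g"
  shows "ell2 (comp_adjoint g)" "ell2_sq (comp_adjoint g) \<le> (sqrt (ell2_sq g) / (1 - r0))\<^sup>2"
proof -
  have *: "trunc_norm d (comp_adjoint g) \<le> sqrt (ell2_sq g) / (1 - r0)" for d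
  proof -
    define u where "u = comp_adjoint g"
    have "complex_of_real (trunc_sq d u) = (\<Sum>\<alpha> | length \<alpha> \<le> d. u \<alpha> * cnj (u \<alpha>))"
      by (simp add: trunc_sq_def complex_norm_square[symmetric] del: of_real_power)
    also have "\<dots> = ell2_inner (comp_coeff p d u) g"
      by (simp add: ell2_inner_comp_coeff[OF assms] u_def)
    finally have "trunc_sq d u = cmod (ell2_inner (comp_coeff p d u) g)"
      by (metis norm_of_real abs_of_nonneg trunc_sq_nonneg)
    also have "\<dots> \<le> sqrt (ell2_sq (comp_coeff p d u)) * sqrt (ell2_sq g)"
      by (rule ell2_inner_bound(2)[OF ell2_comp_coeff assms])
    also have "\<dots> \<le> (trunc_norm d u / (1 - r0)) * sqrt (ell2_sq g)"
    proof (rule mult_right_mono)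
      have "ell2_sq (comp_coeff p d u) \<le> (trunc_norm d u / (1 - r0))\<^sup>2"
      proof (rule ell2I(2))
        show "trunc_sq N (comp_coeff p d u) \<le> (trunc_norm d u / (1 - r0))\<^sup>2" for N
          using power_mono[OF trunc_norm_comp[of N d u] trunc_norm_nonneg, of 2]
          by (simp only: trunc_norm_sq)
      qed
      then show "sqrt (ell2_sq (comp_coeff p d u)) \<le> trunc_norm d u / (1 - r0)"
        using r0(2) by (intro real_le_lsqrt) auto
    qed simp
    finally have "trunc_norm d u * trunc_norm d u \<le> (sqrt (ell2_sq g) / (1 - r0)) * trunc_norm d u"
      unfolding trunc_norm_sq[symmetric] by (simp add: power2_eq_square mult_ac)
    then show "trunc_norm d u \<le> sqrt (ell2_sq g) / (1 - r0)"
      using r0(2) trunc_norm_nonneg[of d u]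
      by (cases "trunc_norm d u = 0") (simp_all add: mult_le_cancel_right_pos del: times_divide_eq_left)
  qed
  have "trunc_sq N (comp_adjoint g) \<le> (sqrt (ell2_sq g) / (1 - r0))\<^sup>2" for N
    using power_mono[OF * trunc_norm_nonneg, of N 2] by (simp only: trunc_norm_sq)
  from ell2I[of "comp_adjoint g", OF this]
  show "ell2 (comp_adjoint g)" "ell2_sq (comp_adjoint g) \<le> (sqrt (ell2_sq g) / (1 - r0))\<^sup>2" .
qed

text \<open>For polynomials this is linearity. The left side passes to the limit because the
  composites converge in norm, the right side because the products of coefficients are
  summable.\<close>

lemma ell2_inner_comp_limit:
  assumes "ell2 a" "ell2 g"
  shows "ell2_inner (comp_limit a) g = ell2_inner a (comp_adjoint g)"
proof -
  have "(\<lambda>d. \<Sum>\<alpha> | length \<alpha> \<le> d. a \<alpha> * cnj (comp_adjoint g \<alpha>)) \<longlonglongrightarrow> ell2_inner a (comp_adjoint g)"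
    unfolding ell2_inner_def
    by (intro summable_on_length_tendsto ell2_inner_bound comp_adjoint_bound assms)
  then have 1: "(\<lambda>d. ell2_inner (comp_coeff p d a) g) \<longlonglongrightarrow> ell2_inner a (comp_adjoint g)"
    by (simp only: ell2_inner_comp_coeff[OF assms(2)])
  have "(\<lambda>d. ell2_inner (comp_limit a) g - ell2_inner (comp_coeff p d a) g) \<longlonglongrightarrow> 0"
  proof (rule Lim_null_comparison)
    have "norm (ell2_inner (comp_limit a) g - ell2_inner (comp_coeff p d a) g)
        \<le> tail_bound a d * sqrt (ell2_sq g)" for d
    proof -
      define h where "h \<gamma> = comp_limit a \<gamma> - comp_coeff p d a \<gamma>" for \<gamma>
      have h: "ell2 h" "sqrt (ell2_sq h) \<le> tail_bound a d"
        unfolding h_def[abs_def] by (rule comp_limit_tail[OF assms(1)])+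
      have "ell2_inner (comp_limit a) g - ell2_inner (comp_coeff p d a) g = ell2_inner h g"
        unfolding h_def[abs_def]
        by (intro ell2_inner_diff_left[symmetric] comp_limit_bound ell2_comp_coeff assms)
      then show ?thesis
        using order_trans[OF ell2_inner_bound(2)[OF h(1) assms(2)] mult_right_mono[OF h(2), of "sqrt (ell2_sq g)"]]
        by simp
    qed
    then show "\<forall>\<^sub>F d in sequentially. norm (ell2_inner (comp_limit a) g - ell2_inner (comp_coeff p d a) g)
        \<le> tail_bound a d * sqrt (ell2_sq g)"
      by (intro always_eventually allI)
    show "(\<lambda>d. tail_bound a d * sqrt (ell2_sq g)) \<longlonglongrightarrow> 0"
      by (rule tendsto_mult_left_zero[OF tail_bound_tendsto[OF assms(1)]])
  qed
  then have "(\<lambda>d. ell2_inner (comp_coeff p d a) g) \<longlonglongrightarrow> ell2_inner (comp_limit a) g"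
    using tendsto_diff[OF tendsto_const[of "ell2_inner (comp_limit a) g"]] by fastforce
  with 1 show ?thesis
    using LIMSEQ_unique by blast
qed

end

section \<open>Operator evaluation of free power series\<close>

text \<open>Completeness passes from H to its operators, so absolutely convergent operator series
  converge.\<close>

instance chilbert_space \<subseteq> banach ..

lemma scale_op_apply [simp]: "blinfun_apply (scale_op c T) x = c *\<^sub>C blinfun_apply T x"
  by (simp add: scale_op.rep_eq)

lemma BH_apply: "T \<in> BH \<Longrightarrow> blinfun_apply T (c *\<^sub>C x) = c *\<^sub>C blinfun_apply T x"
  by (simp add: BH_def)

lemma nc_ball_BH: "X \<in> nc_ball \<Longrightarrow> X i \<in> BH"
  by (simp add: nc_ball_def)

section \<open>Homogeneous parts and evaluation on the ball\<close>

definition homog_part ::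
  "('n::finite \<Rightarrow> ('h::chilbert_space \<Rightarrow>\<^sub>L 'h)) \<Rightarrow> nat \<Rightarrow> ('n list \<Rightarrow> complex) \<Rightarrow> ('h \<Rightarrow>\<^sub>L 'h)" where
  "homog_part X k a = (\<Sum>\<alpha> | length \<alpha> = k. scale_op (a \<alpha>) (word_op X \<alpha>))"

lemma homog_part_apply:
  "homog_part X k a x = (\<Sum>\<alpha> | length \<alpha> = k. a \<alpha> *\<^sub>C word_op X \<alpha> x)"
  by (simp add: homog_part_def blinfun.sum_left)

lemma homog_part_0: "homog_part X 0 a = scale_op (a []) id_blinfun"
  by (simp add: homog_part_def)

lemma homog_part_Suc:
  assumes "\<And>i. X i \<in> BH"
  shows "homog_part X (Suc k) a = (\<Sum>i\<in>UNIV. X i o\<^sub>L homog_part X k (\<lambda>\<alpha>. a (i # \<alpha>)))"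
  by (rule blinfun_eqI)
    (simp add: homog_part_apply sum_length_Suc blinfun.sum_left blinfun.sum_right BH_apply[OF assms])

lemma homog_part_add:
  "homog_part X k (\<lambda>\<alpha>. a \<alpha> + b \<alpha>) = homog_part X k a + homog_part X k b"
  by (rule blinfun_eqI) (simp add: homog_part_apply blinfun.add_left scaleC_add_left sum.distrib)

lemma homog_part_scale:
  "homog_part X k (\<lambda>\<alpha>. c * a \<alpha>) = scale_op c (homog_part X k a)"
  by (rule blinfun_eqI) (simp add: homog_part_apply scaleC_sum_right scaleC_scaleC)

text \<open>The words of length \<open>k\<close> in X form a row of norm at most
  \<open>r ^ k\<close>, by one use of the row bound per letter. Hence the coefficients enter through
  their square sum rather than their absolute sum.\<close>

lemma homog_part_apply_bound:
  assumes "row_bound r X" "\<And>i. X i \<in> BH"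
  shows "(norm (homog_part X k a x))\<^sup>2 \<le> (r ^ k)\<^sup>2 * (\<Sum>\<alpha> | length \<alpha> = k. (cmod (a \<alpha>))\<^sup>2) * (norm x)\<^sup>2"
proof (induction k arbitrary: a)
  case 0
  show ?case
    by (simp add: homog_part_0 norm_scaleC power_mult_distrib)
next
  case (Suc k)
  have "(norm (homog_part X (Suc k) a x))\<^sup>2
      = (norm (\<Sum>i\<in>UNIV. X i (homog_part X k (\<lambda>\<alpha>. a (i # \<alpha>)) x)))\<^sup>2"
    by (simp add: homog_part_Suc[OF assms(2)] blinfun.sum_left)
  also have "\<dots> \<le> r\<^sup>2 * (\<Sum>i\<in>UNIV. (norm (homog_part X k (\<lambda>\<alpha>. a (i # \<alpha>)) x))\<^sup>2)"
    using assms(1) by (simp add: row_bound_def)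
  also have "\<dots> \<le> r\<^sup>2 * (\<Sum>i\<in>UNIV. (r ^ k)\<^sup>2 * (\<Sum>\<alpha> | length \<alpha> = k. (cmod (a (i # \<alpha>)))\<^sup>2) * (norm x)\<^sup>2)"
    by (intro mult_left_mono sum_mono Suc) simp
  also have "\<dots> = (r ^ Suc k)\<^sup>2 * (\<Sum>\<alpha> | length \<alpha> = Suc k. (cmod (a \<alpha>))\<^sup>2) * (norm x)\<^sup>2"
    by (simp add: sum_length_Suc power_mult_distrib flip: sum_distrib_left sum_distrib_right)
  finally show ?case .
qed

lemma norm_homog_part_le:
  fixes X :: "'n::finite \<Rightarrow> ('h::chilbert_space \<Rightarrow>\<^sub>L 'h)"
  assumes "row_bound r X" "\<And>i. X i \<in> BH" "ell2 a"
  shows "norm (homog_part X k a) \<le> r ^ k * sqrt (ell2_sq a)"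
proof (rule norm_blinfun_bound)
  have r: "0 \<le> r"
    using assms(1) by (simp add: row_bound_def)
  then show "0 \<le> r ^ k * sqrt (ell2_sq a)" by simp
  fix x :: 'h
  have "(\<Sum>\<alpha> | length \<alpha> = k. (cmod (a \<alpha>))\<^sup>2) \<le> trunc_sq k a"
    unfolding trunc_sq_def by (rule sum_mono2) auto
  also have "\<dots> \<le> ell2_sq a"
    by (rule trunc_sq_le_ell2_sq[OF assms(3)])
  finally have "(r ^ k)\<^sup>2 * (\<Sum>\<alpha> | length \<alpha> = k. (cmod (a \<alpha>))\<^sup>2) * (norm x)\<^sup>2
      \<le> (r ^ k)\<^sup>2 * ell2_sq a * (norm x)\<^sup>2"
    by (intro mult_right_mono mult_left_mono) auto
  with homog_part_apply_bound[OF assms(1,2), of k a x]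
  have "(norm (homog_part X k a x))\<^sup>2 \<le> (r ^ k * sqrt (ell2_sq a) * norm x)\<^sup>2"
    by (simp add: power_mult_distrib)
  then show "norm (homog_part X k a x) \<le> r ^ k * sqrt (ell2_sq a) * norm x"
    by (rule power2_le_imp_le) (simp add: r)
qed

definition free_eval :: "('n::finite list \<Rightarrow> complex) \<Rightarrow> ('n, 'h::chilbert_space) ncfun" where
  "free_eval a = (\<lambda>X\<in>nc_ball. \<Sum>k. homog_part X k a)"

text \<open>The constant 1 / (1 - r) depends on the point alone, so evaluation at a point of the
  ball is continuous in the norm of the coefficients.\<close>

lemma homog_part_norm_sums:
  fixes X :: "'n::finite \<Rightarrow> ('h::chilbert_space \<Rightarrow>\<^sub>L 'h)"
  assumes "X \<in> nc_ball"
  obtains C where "0 \<le> C" "\<And>a. ell2 a \<Longrightarrow> summable (\<lambda>k. norm (homog_part X k a))"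
    "\<And>a. ell2 a \<Longrightarrow> norm (\<Sum>k. homog_part X k a) \<le> C * sqrt (ell2_sq a)"
proof -
  obtain r where r: "r < 1" "row_bound r X"
    using nc_ball_row_bound[OF assms] by blast
  have r0: "0 \<le> r"
    using r(2) by (simp add: row_bound_def)
  have le: "norm (homog_part X k a) \<le> r ^ k * sqrt (ell2_sq a)" if "ell2 a" for k a
    by (rule norm_homog_part_le[OF r(2) nc_ball_BH[OF assms] that])
  have geo: "(\<lambda>k. r ^ k * sqrt (ell2_sq a)) sums (1 / (1 - r) * sqrt (ell2_sq a))" for a :: "'n list \<Rightarrow> complex"
    using r r0 by (intro sums_mult2 geometric_sums) simp
  have summ: "summable (\<lambda>k. norm (homog_part X k a))" if "ell2 a" for a
    by (rule summable_comparison_test[OF _ sums_summable[OF geo[of a]]]) (use le[OF that] in auto)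
  have "norm (\<Sum>k. homog_part X k a) \<le> 1 / (1 - r) * sqrt (ell2_sq a)" if "ell2 a" for a
  proof -
    have "norm (\<Sum>k. homog_part X k a) \<le> (\<Sum>k. norm (homog_part X k a))"
      by (rule summable_norm[OF summ[OF that]])
    also have "\<dots> \<le> (\<Sum>k. r ^ k * sqrt (ell2_sq a))"
      by (rule suminf_le[OF le[OF that] summ[OF that] sums_summable[OF geo[of a]]])
    also have "\<dots> = 1 / (1 - r) * sqrt (ell2_sq a)"
      by (rule sums_unique[OF geo[of a], symmetric])
    finally show ?thesis .
  qed
  with r(1) summ show ?thesis
    by (intro that[of "1 / (1 - r)"]) auto
qed

lemma summable_norm_homog_part:
  "X \<in> nc_ball \<Longrightarrow> ell2 a \<Longrightarrow> summable (\<lambda>k. norm (homog_part X k a))"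
  using homog_part_norm_sums by metis

lemma free_eval_sums: "X \<in> nc_ball \<Longrightarrow> ell2 a \<Longrightarrow> (\<lambda>k. homog_part X k a) sums free_eval a X"
  unfolding free_eval_def
  by (simp add: summable_sums summable_norm_cancel[OF summable_norm_homog_part])

lemma free_eval_bound:
  fixes X :: "'n::finite \<Rightarrow> ('h::chilbert_space \<Rightarrow>\<^sub>L 'h)"
  assumes "X \<in> nc_ball"
  obtains C where "0 \<le> C" "\<And>a. ell2 a \<Longrightarrow> norm (free_eval a X) \<le> C * sqrt (ell2_sq a)"
  using homog_part_norm_sums[OF assms] assms unfolding free_eval_def by (metis restrict_apply')

lemma free_eval_add:
  assumes "X \<in> nc_ball" "ell2 a" "ell2 b"
  shows "free_eval (\<lambda>\<alpha>. a \<alpha> + b \<alpha>) X = free_eval a X + free_eval b X"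
  using sums_unique2[OF free_eval_sums[OF assms(1) ell2_add[OF assms(2,3)], unfolded homog_part_add]
      sums_add[OF free_eval_sums[OF assms(1,2)] free_eval_sums[OF assms(1,3)]]] .

lemma bounded_linear_scale_op: "bounded_linear (scale_op c)"
proof (rule bounded_linear_intro)
  show "scale_op c (S + T) = scale_op c S + scale_op c T" for S T :: "'a \<Rightarrow>\<^sub>L 'a"
    by (rule blinfun_eqI) (simp add: blinfun.add_left scaleC_add_right)
  show "scale_op c (r *\<^sub>R S) = r *\<^sub>R scale_op c S" for r and S :: "'a \<Rightarrow>\<^sub>L 'a"
    by (rule blinfun_eqI) (simp add: blinfun.scaleR_left scaleC_scaleR)
  show "norm (scale_op c S) \<le> norm S * cmod c" for S :: "'a \<Rightarrow>\<^sub>L 'a"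
  proof (rule norm_blinfun_bound)
    show "norm (scale_op c S x) \<le> norm S * cmod c * norm x" for x
      using mult_left_mono[OF norm_blinfun[of S x], of "cmod c"] by (simp add: norm_scaleC mult_ac)
  qed simp
qed

lemma free_eval_scale:
  assumes "X \<in> nc_ball" "ell2 a"
  shows "free_eval (\<lambda>\<alpha>. c * a \<alpha>) X = scale_op c (free_eval a X)"
  using sums_unique2[OF free_eval_sums[OF assms(1) ell2_scale[OF assms(2)], unfolded homog_part_scale]
      bounded_linear.sums[OF bounded_linear_scale_op free_eval_sums[OF assms]]] .

lemma free_eval_diff:
  assumes "X \<in> nc_ball" "ell2 a" "ell2 b"
  shows "free_eval (\<lambda>\<alpha>. a \<alpha> - b \<alpha>) X = free_eval a X - free_eval b X"
  using free_eval_add[OF assms(1) ell2_diff[OF assms(2,3)] assms(3)] by simp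

lemma free_eval_sum:
  assumes "X \<in> nc_ball" "\<And>i. i \<in> I \<Longrightarrow> ell2 (a i)"
  shows "free_eval (\<lambda>\<alpha>. \<Sum>i\<in>I. a i \<alpha>) X = (\<Sum>i\<in>I. free_eval (a i) X)"
  using assms(2)
proof (induction I rule: infinite_finite_induct)
  case (insert i I)
  then show ?case
    using free_eval_add[OF assms(1), of "a i" "\<lambda>\<alpha>. \<Sum>i\<in>I. a i \<alpha>"] ell2_sum[of I a] by simp
qed (use free_eval_diff[OF assms(1) ell2_zero ell2_zero] in simp_all)

lemma free_eval_constant:
  assumes "X \<in> nc_ball"
  shows "free_eval (\<lambda>\<gamma>. c * monomial [] \<gamma>) X = scale_op c id_blinfun"
proof -
  have "homog_part X k (\<lambda>\<gamma>. c * monomial [] \<gamma>) = 0" if "k \<notin> {0}" for k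
  proof (rule blinfun_eqI)
    show "homog_part X k (\<lambda>\<gamma>. c * monomial [] \<gamma>) x = blinfun_apply 0 x" for x
      unfolding homog_part_apply using that by (auto intro!: sum.neutral simp: monomial_def)
  qed
  then have "(\<lambda>k. homog_part X k (\<lambda>\<gamma>. c * monomial [] \<gamma>)) sums (\<Sum>k\<in>{0}. homog_part X k (\<lambda>\<gamma>. c * monomial [] \<gamma>))"
    by (intro sums_finite) auto
  then have "(\<lambda>k. homog_part X k (\<lambda>\<gamma>. c * monomial [] \<gamma>)) sums scale_op c id_blinfun"
    by (simp add: homog_part_0 monomial_def)
  then show ?thesis
    using sums_unique2 free_eval_sums[OF assms ell2_scale[OF ell2_monomial]] by blast
qed

lemma limsup_root_le_1:
  assumes "\<And>k. 0 \<le> s k" "\<And>k. s k \<le> B"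
  shows "limsup (\<lambda>k. ereal (root (2 * k) (s k))) \<le> 1"
proof -
  \<comment> \<open>Adding 1 makes the radicand positive even if \<open>B\<close> is 0, which the
    limit of the roots requires.\<close>
  have "(\<lambda>n. root n (B + 1)) \<longlonglongrightarrow> 1"
    using assms(1)[of 0] assms(2)[of 0] by (intro LIMSEQ_root_const) linarith
  then have "((\<lambda>n. root n (B + 1)) \<circ> (\<lambda>k. 2 * k)) \<longlonglongrightarrow> 1"
    by (rule LIMSEQ_subseq_LIMSEQ) (simp add: strict_mono_def)
  then have "limsup (\<lambda>k. ereal (root (2 * k) (B + 1))) = ereal 1"
    by (intro lim_imp_Limsup) (simp_all add: o_def)
  \<comment> \<open>At \<open>k = 0\<close> both roots are 0 by convention.\<close>
  moreover have "root (2 * k) (s k) \<le> root (2 * k) (B + 1)" for k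
    using assms(2)[of k] by (cases "k = 0") auto
  ultimately show ?thesis
    using Limsup_mono[of "\<lambda>k. ereal (root (2 * k) (s k))" "\<lambda>k. ereal (root (2 * k) (B + 1))" sequentially]
    by (simp add: one_ereal_def)
qed

lemma has_free_series_free_eval:
  assumes "ell2 a"
  shows "has_free_series (free_eval a :: ('n::finite, 'h::chilbert_space) ncfun) a"
proof -
  have "(\<Sum>\<alpha> | length \<alpha> = k. (cmod (a \<alpha>))\<^sup>2) \<le> ell2_sq a" for k
  proof -
    have "(\<Sum>\<alpha> | length \<alpha> = k. (cmod (a \<alpha>))\<^sup>2) \<le> trunc_sq k a"
      unfolding trunc_sq_def by (rule sum_mono2) auto
    also have "\<dots> \<le> ell2_sq a"
      by (rule trunc_sq_le_ell2_sq[OF assms])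
    finally show ?thesis .
  qed
  then have "limsup (\<lambda>k. ereal (root (2 * k) (\<Sum>\<alpha> | length \<alpha> = k. (cmod (a \<alpha>))\<^sup>2))) \<le> 1"
    by (intro limsup_root_le_1 sum_nonneg) auto
  moreover have "free_eval a \<in> extensional nc_ball"
    by (simp add: free_eval_def)
  ultimately show ?thesis
    unfolding has_free_series_def homog_part_def[symmetric] using free_eval_sums[OF _ assms] by blast
qed

lemma has_free_series_sums:
  "has_free_series f a \<Longrightarrow> X \<in> nc_ball \<Longrightarrow> (\<lambda>k. homog_part X k a) sums f X"
  by (simp add: has_free_series_def homog_part_def)

lemma has_free_series_eq_free_eval:
  fixes f :: "('n::finite, 'h::chilbert_space) ncfun"
  assumes "has_free_series f a"
  shows "f = free_eval a"
proof (rule extensionalityI[of _ nc_ball])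
  show "f \<in> extensional nc_ball"
    using assms by (simp add: has_free_series_def)
  show "free_eval a \<in> extensional nc_ball"
    by (simp add: free_eval_def)
  show "f X = free_eval a X" if "X \<in> nc_ball" for X
    using sums_unique[OF has_free_series_sums[OF assms that]] that by (simp add: free_eval_def)
qed

text \<open>Square and triangular partial sums differ by the terms with i + j at least n. Their norm
  is dominated by the same difference for the series of norms, which tends to 0 by the scalar Cauchy
  product.\<close>

lemma blinfun_Cauchy_product_sums:
  fixes A :: "nat \<Rightarrow> ('b::banach \<Rightarrow>\<^sub>L 'c::banach)" and B :: "nat \<Rightarrow> ('a::real_normed_vector \<Rightarrow>\<^sub>L 'b)"
  assumes A: "summable (\<lambda>k. norm (A k))" and B: "summable (\<lambda>k. norm (B k))"
  shows "(\<lambda>k. \<Sum>i\<le>k. A i o\<^sub>L B (k - i)) sums (suminf A o\<^sub>L suminf B)"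
proof -
  interpret comp: bounded_bilinear "(o\<^sub>L) :: ('b \<Rightarrow>\<^sub>L 'c) \<Rightarrow> ('a \<Rightarrow>\<^sub>L 'b) \<Rightarrow> ('a \<Rightarrow>\<^sub>L 'c)"
    by (rule bounded_bilinear_blinfun_compose)
  define P where "P n = (\<Sum>i<n. A i) o\<^sub>L (\<Sum>j<n. B j)" for n
  define T where "T n = (\<Sum>k<n. \<Sum>i\<le>k. A i o\<^sub>L B (k - i))" for n
  define p where "p n = (\<Sum>i<n. norm (A i)) * (\<Sum>j<n. norm (B j))" for n
  define t where "t n = (\<Sum>k<n. \<Sum>i\<le>k. norm (A i) * norm (B (k - i)))" for n
  have sub: "{(i, j). i + j < n} \<subseteq> {..<n} \<times> {..<n}" for n :: nat
    by auto
  have split: "(\<Sum>(i, j)\<in>{..<n} \<times> {..<n}. g i j) - (\<Sum>k<n. \<Sum>i\<le>k. g i (k - i))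
      = (\<Sum>(i, j)\<in>{..<n} \<times> {..<n} - {(i, j). i + j < n}. g i j)"
    for n and g :: "nat \<Rightarrow> nat \<Rightarrow> 'd::ab_group_add"
    unfolding sum.triangle_reindex[symmetric] by (rule sum_diff[symmetric]) (use sub in auto)
  have PT: "P n - T n = (\<Sum>(i, j)\<in>{..<n} \<times> {..<n} - {(i, j). i + j < n}. A i o\<^sub>L B j)" for n
  proof -
    have "P n = (\<Sum>i<n. \<Sum>j<n. A i o\<^sub>L B j)"
      unfolding P_def comp.sum_left by (simp only: comp.sum_right)
    then show ?thesis
      unfolding split[symmetric] T_def by (simp only: sum.cartesian_product)
  qed
  have pt: "p n - t n = (\<Sum>(i, j)\<in>{..<n} \<times> {..<n} - {(i, j). i + j < n}. norm (A i) * norm (B j))" for n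
    unfolding split[symmetric] p_def t_def sum_product sum.cartesian_product ..
  have le: "norm (P n - T n) \<le> p n - t n" for n
    unfolding PT pt by (rule sum_norm_le) (auto intro: norm_blinfun_compose)
  have "p \<longlonglongrightarrow> (\<Sum>i. norm (A i)) * (\<Sum>j. norm (B j))"
    unfolding p_def using A B by (intro tendsto_mult summable_LIMSEQ)
  moreover have "t \<longlonglongrightarrow> (\<Sum>i. norm (A i)) * (\<Sum>j. norm (B j))"
    using Cauchy_product_sums[of "\<lambda>i. norm (A i)" "\<lambda>j. norm (B j)"] A B
    by (simp add: sums_def t_def[abs_def])
  ultimately have "(\<lambda>n. p n - t n) \<longlonglongrightarrow> 0"
    using tendsto_diff by fastforce
  then have "(\<lambda>n. P n - T n) \<longlonglongrightarrow> 0"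
    by (rule Lim_null_comparison[rotated]) (use le in auto)
  moreover have "P \<longlonglongrightarrow> (suminf A o\<^sub>L suminf B)"
    unfolding P_def
    by (intro comp.tendsto summable_LIMSEQ summable_norm_cancel[OF A] summable_norm_cancel[OF B])
  ultimately have "(\<lambda>n. P n - (P n - T n)) \<longlonglongrightarrow> (suminf A o\<^sub>L suminf B) - 0"
    by (intro tendsto_diff)
  then show ?thesis
    by (simp add: sums_def T_def)
qed

lemma homog_part_conv:
  assumes "\<And>i. X i \<in> BH"
  shows "homog_part X k (conv a b) = (\<Sum>j\<le>k. homog_part X j a o\<^sub>L homog_part X (k - j) b)"
proof (induction k arbitrary: a)
  case 0
  show ?case
    by (rule blinfun_eqI) (simp add: homog_part_0 scaleC_scaleC)
next
  case (Suc k)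
  interpret comp: bounded_bilinear "(o\<^sub>L) :: ('b \<Rightarrow>\<^sub>L 'b) \<Rightarrow> ('b \<Rightarrow>\<^sub>L 'b) \<Rightarrow> ('b \<Rightarrow>\<^sub>L 'b)"
    by (rule bounded_bilinear_blinfun_compose)
  have assoc: "R o\<^sub>L (S o\<^sub>L T) = (R o\<^sub>L S) o\<^sub>L T" for R S T :: "'b \<Rightarrow>\<^sub>L 'b"
    by (rule blinfun_eqI) simp
  have tail: "homog_part X k (\<lambda>\<gamma>. conv a b (i # \<gamma>))
      = scale_op (a []) (homog_part X k (\<lambda>\<gamma>. b (i # \<gamma>)))
        + (\<Sum>j\<le>k. homog_part X j (\<lambda>\<alpha>. a (i # \<alpha>)) o\<^sub>L homog_part X (k - j) b)" for i
    by (simp add: homog_part_add homog_part_scale Suc)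
  have "homog_part X (Suc k) (conv a b)
      = (\<Sum>i\<in>UNIV. X i o\<^sub>L scale_op (a []) (homog_part X k (\<lambda>\<gamma>. b (i # \<gamma>))))
        + (\<Sum>i\<in>UNIV. \<Sum>j\<le>k. X i o\<^sub>L (homog_part X j (\<lambda>\<alpha>. a (i # \<alpha>)) o\<^sub>L homog_part X (k - j) b))"
    by (simp only: homog_part_Suc[OF assms] tail comp.add_right comp.sum_right sum.distrib)
  also have "(\<Sum>i\<in>UNIV. X i o\<^sub>L scale_op (a []) (homog_part X k (\<lambda>\<gamma>. b (i # \<gamma>))))
      = homog_part X 0 a o\<^sub>L homog_part X (Suc k) b"
    by (rule blinfun_eqI)
      (simp add: homog_part_0 homog_part_Suc[OF assms] blinfun.sum_left scaleC_sum_right BH_apply[OF assms])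
  also have "(\<Sum>i\<in>UNIV. \<Sum>j\<le>k. X i o\<^sub>L (homog_part X j (\<lambda>\<alpha>. a (i # \<alpha>)) o\<^sub>L homog_part X (k - j) b))
      = (\<Sum>j\<le>k. homog_part X (Suc j) a o\<^sub>L homog_part X (k - j) b)"
    by (subst sum.swap) (simp add: homog_part_Suc[OF assms] comp.sum_left assoc)
  finally show ?case
    by (simp add: sum.atMost_Suc_shift del: sum.atMost_Suc)
qed

lemma free_eval_conv:
  assumes X: "X \<in> nc_ball" and "ell2 a" "ell2 b" "ell2 (conv a b)"
  shows "free_eval (conv a b) X = free_eval a X o\<^sub>L free_eval b X"
proof -
  have "(\<lambda>k. homog_part X k (conv a b)) sums ((\<Sum>k. homog_part X k a) o\<^sub>L (\<Sum>k. homog_part X k b))"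
    unfolding homog_part_conv[OF nc_ball_BH[OF X]]
    by (intro blinfun_Cauchy_product_sums summable_norm_homog_part assms)
  from sums_unique2[OF free_eval_sums[OF X assms(4)] this] show ?thesis
    using X by (simp add: free_eval_def)
qed

section \<open>Evaluation at truncated weighted shifts\<close>

locale infinite_dimensional =
  fixes H :: "'h::chilbert_space itself"
  assumes infinite_dim: "\<nexists>B::'h set. finite B \<and> module.span scaleC B = UNIV"
begin

text \<open>Gram-Schmidt: finitely many vectors never span H, so a vector outside their span has a
  nonzero residual, which is then normalised.\<close>

lemma orthonormal_family:
  assumes "finite I"
  shows "\<exists>e :: 'i \<Rightarrow> 'h. \<forall>i\<in>I. \<forall>j\<in>I. cinner (e i) (e j) = of_bool (i = j)"
  using assms
proof (induction I)
  case (insert k I)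
  interpret V: vector_space "scaleC :: complex \<Rightarrow> 'h \<Rightarrow> 'h"
    by (rule vector_space_scaleC)
  obtain e :: "'i \<Rightarrow> 'h" where e: "\<And>i j. i \<in> I \<Longrightarrow> j \<in> I \<Longrightarrow> cinner (e i) (e j) = of_bool (i = j)"
    using insert.IH by blast
  have "V.span (e ` I) \<noteq> UNIV"
    using infinite_dim insert.hyps(1) by blast
  then obtain x where x: "x \<notin> V.span (e ` I)"
    by blast
  define y where "y = x - (\<Sum>i\<in>I. cinner x (e i) *\<^sub>C e i)"
  have "(\<Sum>i\<in>I. cinner x (e i) *\<^sub>C e i) \<in> V.span (e ` I)"
    by (intro V.span_sum V.span_scale V.span_base) auto
  with x have "y \<noteq> 0"
    by (auto simp: y_def)
  have orth: "cinner y (e j) = 0" if "j \<in> I" for j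
  proof -
    have "(\<Sum>i\<in>I. cinner x (e i) * cinner (e i) (e j)) = (\<Sum>i\<in>I. if i = j then cinner x (e i) else 0)"
      by (rule sum.cong) (auto simp: e that)
    then show ?thesis
      using insert.hyps(1) that
      by (simp add: y_def cinner_diff_left cinner_sum_left cinner_scaleC_left)
  qed
  then have orth': "cinner (e j) y = 0" if "j \<in> I" for j
    using that cinner_commute[of "e j" y] by simp
  define u where "u = complex_of_real (inverse (norm y)) *\<^sub>C y"
  have u: "cinner u u = 1"
    using \<open>y \<noteq> 0\<close>
    by (simp add: u_def cinner_self norm_scaleC norm_inverse)
  have "cinner u (e j) = 0" "cinner (e j) u = 0" if "j \<in> I" for j
    using that by (simp_all add: u_def cinner_scaleC_left cinner_scaleC_right orth orth')
  then have "\<forall>i\<in>insert k I. \<forall>j\<in>insert k I. cinner ((e(k := u)) i) ((e(k := u)) j) = of_bool (i = j)"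
    using insert.hyps(2) u e by auto
  then show ?case by blast
qed simp

end

text \<open>A finite piece of the full Fock space inside H. The bound is \<open>Suc M\<close>
  because the shifts act on words of length at most \<open>M\<close> and lengthen them by one
  letter.\<close>

locale orthonormal_words =
  fixes e :: "'n::finite list \<Rightarrow> 'h::chilbert_space" and M :: nat and r :: real
  assumes orthonormal:
      "length \<alpha> \<le> Suc M \<Longrightarrow> length \<beta> \<le> Suc M \<Longrightarrow> cinner (e \<alpha>) (e \<beta>) = of_bool (\<alpha> = \<beta>)"
    and r: "0 \<le> r" "r < 1"
begin

definition synth :: "('n list \<Rightarrow> complex) \<Rightarrow> 'h" where
  "synth b = (\<Sum>\<alpha> | length \<alpha> \<le> Suc M. b \<alpha> *\<^sub>C e \<alpha>)"

lemma synth_cong: "(\<And>\<alpha>. length \<alpha> \<le> Suc M \<Longrightarrow> b \<alpha> = c \<alpha>) \<Longrightarrow> synth b = synth c"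
  unfolding synth_def by (rule sum.cong) auto

lemma synth_sum: "synth (\<lambda>\<alpha>. \<Sum>i\<in>I. b i \<alpha>) = (\<Sum>i\<in>I. synth (b i))"
  unfolding synth_def by (subst sum.swap) (simp add: scaleC_sum_left)

lemma synth_scale: "synth (\<lambda>\<alpha>. c * b \<alpha>) = c *\<^sub>C synth b"
  by (simp add: synth_def scaleC_sum_right scaleC_scaleC)

lemma synth_zero [simp]: "synth (\<lambda>\<alpha>. 0) = 0"
  by (simp add: synth_def)

lemma cinner_synth: "length \<gamma> \<le> Suc M \<Longrightarrow> cinner (synth b) (e \<gamma>) = b \<gamma>"
proof -
  assume \<gamma>: "length \<gamma> \<le> Suc M"
  have "cinner (synth b) (e \<gamma>) = (\<Sum>\<alpha> | length \<alpha> \<le> Suc M. if \<alpha> = \<gamma> then b \<alpha> else 0)"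
    unfolding synth_def cinner_sum_left cinner_scaleC_left
    by (rule sum.cong) (auto simp: orthonormal \<gamma>)
  with \<gamma> show ?thesis by simp
qed

lemma cinner_synth_right: "cinner x (synth b) = (\<Sum>\<alpha> | length \<alpha> \<le> Suc M. cnj (b \<alpha>) * cinner x (e \<alpha>))"
  by (simp add: synth_def cinner_sum_right cinner_scaleC_right)

lemma norm_synth: "(norm (synth b))\<^sup>2 = trunc_sq (Suc M) b"
proof -
  have "complex_of_real ((norm (synth b))\<^sup>2) = cinner (synth b) (synth b)"
    by (simp only: cinner_self)
  also have "\<dots> = (\<Sum>\<alpha> | length \<alpha> \<le> Suc M. cnj (b \<alpha>) * b \<alpha>)"
    unfolding cinner_synth_right by (rule sum.cong) (auto simp: cinner_synth)
  also have "\<dots> = complex_of_real (trunc_sq (Suc M) b)"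
    by (simp add: trunc_sq_def complex_norm_square mult.commute del: of_real_power)
  finally show ?thesis
    by (simp only: of_real_eq_iff)
qed

text \<open>\<open>synth c\<close> is the orthogonal projection of \<open>x\<close> onto the span of
  the family, hence no longer than \<open>x\<close>.\<close>

lemma Bessel: "trunc_sq (Suc M) (\<lambda>\<alpha>. cinner x (e \<alpha>)) \<le> (norm x)\<^sup>2"
proof -
  define c where "c \<alpha> = cinner x (e \<alpha>)" for \<alpha>
  have "complex_of_real (trunc_sq (Suc M) c) = cinner x (synth c)"
    by (simp add: cinner_synth_right c_def trunc_sq_def complex_norm_square mult.commute del: of_real_power)
  then have "trunc_sq (Suc M) c = cmod (cinner x (synth c))"
    by (metis norm_of_real abs_of_nonneg trunc_sq_nonneg)
  also have "\<dots> \<le> norm x * norm (synth c)"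
    by (rule cinner_Cauchy_Schwarz)
  finally have "norm (synth c) * norm (synth c) \<le> norm x * norm (synth c)"
    unfolding norm_synth[symmetric] by (simp add: power2_eq_square)
  then have "norm (synth c) \<le> norm x"
    by (cases "norm (synth c) = 0") auto
  then have "(norm (synth c))\<^sup>2 \<le> (norm x)\<^sup>2"
    by (intro power_mono) auto
  then show ?thesis
    by (simp add: norm_synth c_def[abs_def])
qed

text \<open>The i-th left creation operator, scaled by \<open>r\<close> and cut off: vectors
  \<open>e \<alpha>\<close> of top length and the orthogonal complement of the family go to
  0.\<close>

definition wshift :: "'n \<Rightarrow> 'h \<Rightarrow>\<^sub>L 'h" where
  "wshift i = Blinfun (\<lambda>x. \<Sum>\<alpha> | length \<alpha> \<le> M. (of_real r * cinner x (e \<alpha>)) *\<^sub>C e (i # \<alpha>))"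

lemma wshift_apply:
  "wshift i x = (\<Sum>\<alpha> | length \<alpha> \<le> M. (of_real r * cinner x (e \<alpha>)) *\<^sub>C e (i # \<alpha>))"
proof -
  have "bounded_linear (\<lambda>x. (of_real r * cinner x u) *\<^sub>C v)" for u v :: 'h
  proof (rule bounded_linear_intro)
    show "(of_real r * cinner (x + y) u) *\<^sub>C v = (of_real r * cinner x u) *\<^sub>C v + (of_real r * cinner y u) *\<^sub>C v" for x y
      by (simp add: cinner_add_left distrib_left scaleC_add_left)
    show "(of_real r * cinner (s *\<^sub>R x) u) *\<^sub>C v = s *\<^sub>R ((of_real r * cinner x u) *\<^sub>C v)" for s x
      by (simp add: scaleC_of_real[symmetric] cinner_scaleC_left scaleC_scaleC mult_ac)
    show "norm ((of_real r * cinner x u) *\<^sub>C v) \<le> norm x * (\<bar>r\<bar> * norm u * norm v)" for x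
      using mult_left_mono[OF cinner_Cauchy_Schwarz[of x u], of "\<bar>r\<bar> * norm v"]
      by (simp add: norm_scaleC norm_mult mult_ac)
  qed
  then have "bounded_linear (\<lambda>x. \<Sum>\<alpha> | length \<alpha> \<le> M. (of_real r * cinner x (e \<alpha>)) *\<^sub>C e (i # \<alpha>))"
    by (intro bounded_linear_sum) auto
  then show ?thesis
    by (simp add: wshift_def bounded_linear_Blinfun_apply)
qed

lemma wshift_BH: "wshift i \<in> BH"
  by (simp add: BH_def wshift_apply cinner_scaleC_left scaleC_sum_right scaleC_scaleC mult_ac)

primrec prepend :: "('n \<Rightarrow> 'n list \<Rightarrow> complex) \<Rightarrow> 'n list \<Rightarrow> complex" where
  "prepend b [] = 0"
| "prepend b (i # \<alpha>) = b i \<alpha>"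

lemma sum_wshift: "(\<Sum>i\<in>UNIV. wshift i (y i)) = synth (prepend (\<lambda>i \<alpha>. of_real r * cinner (y i) (e \<alpha>)))"
  by (simp add: synth_def sum_length_le_Suc wshift_apply)

text \<open>Words with different first letters are orthogonal, so the squared norms of the summands
  add up, and Bessel's inequality bounds each of them.\<close>

lemma wshift_row_bound: "row_bound r wshift"
proof -
  have "(norm (\<Sum>i\<in>UNIV. wshift i (y i)))\<^sup>2 \<le> r\<^sup>2 * (\<Sum>i\<in>UNIV. (norm (y i))\<^sup>2)" for y
  proof -
    have "(norm (\<Sum>i\<in>UNIV. wshift i (y i)))\<^sup>2
        = (\<Sum>i\<in>UNIV. trunc_sq M (\<lambda>\<alpha>. of_real r * cinner (y i) (e \<alpha>)))"
      by (simp add: sum_wshift norm_synth trunc_sq_Suc)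
    also have "\<dots> = r\<^sup>2 * (\<Sum>i\<in>UNIV. trunc_sq M (\<lambda>\<alpha>. cinner (y i) (e \<alpha>)))"
      by (simp add: trunc_sq_scale sum_distrib_left)
    also have "\<dots> \<le> r\<^sup>2 * (\<Sum>i\<in>UNIV. (norm (y i))\<^sup>2)"
      by (intro mult_left_mono sum_mono order_trans[OF trunc_sq_mono[of M "Suc M"] Bessel]) auto
    finally show ?thesis .
  qed
  with r show ?thesis
    by (simp add: row_bound_def)
qed

lemma wshift_nc_ball: "wshift \<in> nc_ball"
  by (rule row_bound_nc_ball[OF wshift_BH wshift_row_bound r(2)])

text \<open>Shifts prepend letters, so a homogeneous part acts on coefficients by convolution. The
  words longer than \<open>Suc M\<close> that convolution produces are invisible to
  \<open>synth\<close>.\<close>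

lemma homog_part_wshift:
  "homog_part wshift k a (synth b)
    = synth (conv (\<lambda>\<alpha>. if length \<alpha> = k then a \<alpha> * of_real r ^ k else 0) b)"
proof (induction k arbitrary: a)
  case 0
  have "conv (\<lambda>\<alpha>. if length \<alpha> = 0 then a \<alpha> * of_real r ^ 0 else 0) b \<gamma> = a [] * b \<gamma>" for \<gamma>
    by (cases \<gamma>) simp_all
  then have "conv (\<lambda>\<alpha>. if length \<alpha> = 0 then a \<alpha> * of_real r ^ 0 else 0) b = (\<lambda>\<gamma>. a [] * b \<gamma>)"
    by blast
  then show ?case
    by (simp only: homog_part_0 scale_op_apply blinfun_apply_id_blinfun synth_scale id_apply)
next
  case (Suc k)
  define h where "h i \<alpha> = (if length \<alpha> = k then a (i # \<alpha>) * of_real r ^ k else 0)" for i \<alpha>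
  define g where "g \<alpha> = (if length \<alpha> = Suc k then a \<alpha> * of_real r ^ Suc k else 0)" for \<alpha>
  have "homog_part wshift (Suc k) a (synth b) = (\<Sum>i\<in>UNIV. wshift i (synth (conv (h i) b)))"
    by (simp add: homog_part_Suc[OF wshift_BH] blinfun.sum_left Suc h_def[abs_def])
  also have "\<dots> = synth (prepend (\<lambda>i \<alpha>. of_real r * cinner (synth (conv (h i) b)) (e \<alpha>)))"
    by (rule sum_wshift)
  also have "\<dots> = synth (conv g b)"
  proof (rule synth_cong)
    fix \<gamma> :: "'n list" assume \<gamma>: "length \<gamma> \<le> Suc M"
    show "prepend (\<lambda>i \<alpha>. of_real r * cinner (synth (conv (h i) b)) (e \<alpha>)) \<gamma> = conv g b \<gamma>"
    proof (cases \<gamma>)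
      case Nil
      then show ?thesis by (simp add: g_def)
    next
      case (Cons i \<beta>)
      have "(\<lambda>\<alpha>. g (i # \<alpha>)) = (\<lambda>\<alpha>. of_real r * h i \<alpha>)"
        by (auto simp: g_def h_def)
      then show ?thesis
        using \<gamma> Cons by (simp add: cinner_synth conv_scale_left) (simp add: g_def)
    qed
  qed
  finally show ?case
    unfolding g_def[abs_def] .
qed

text \<open>Degrees above \<open>Suc M\<close> cannot reach words of length at most
  \<open>Suc M\<close>, so the operator series collapses to a finite sum.\<close>

lemma has_free_series_wshift:
  assumes "has_free_series f a"
  shows "f wshift (synth b) = synth (conv (\<lambda>\<alpha>. a \<alpha> * of_real r ^ length \<alpha>) b)"
proof -
  define h where "h k \<alpha> = (if length \<alpha> = k then a \<alpha> * of_real r ^ k else 0)" for k and \<alpha> :: "'n list"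
  have "(\<lambda>k. homog_part wshift k a (synth b)) sums f wshift (synth b)"
    by (rule bounded_linear.sums[OF blinfun.bounded_linear_left has_free_series_sums[OF assms wshift_nc_ball]])
  then have 1: "(\<lambda>k. synth (conv (h k) b)) sums f wshift (synth b)"
    by (simp add: homog_part_wshift h_def[abs_def])
  have "(\<lambda>k. synth (conv (h k) b)) sums (\<Sum>k\<le>Suc M. synth (conv (h k) b))"
  proof (rule sums_finite)
    fix k assume k: "k \<notin> {..Suc M}"
    have "conv (h k) b \<gamma> = conv (\<lambda>\<alpha>. 0) b \<gamma>" if "length \<gamma> \<le> Suc M" for \<gamma>
      by (rule conv_cong_left) (use that k in \<open>auto simp: h_def\<close>)
    then show "synth (conv (h k) b) = 0"
      using synth_cong[of "conv (h k) b" "\<lambda>\<alpha>. 0"] by simp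
  qed simp
  with 1 have "f wshift (synth b) = (\<Sum>k\<le>Suc M. synth (conv (h k) b))"
    by (rule sums_unique2)
  also have "\<dots> = synth (conv (\<lambda>\<alpha>. \<Sum>k\<le>Suc M. h k \<alpha>) b)"
    by (simp add: conv_sum_left[abs_def] synth_sum[symmetric] del: sum.atMost_Suc)
  also have "\<dots> = synth (conv (\<lambda>\<alpha>. a \<alpha> * of_real r ^ length \<alpha>) b)"
    by (intro synth_cong conv_cong_left) (simp add: h_def del: sum.atMost_Suc)
  finally show ?thesis .
qed

end

section \<open>Uniqueness of coefficients and the row contraction of a self-map\<close>

lemma nc_ball_zero: "(\<lambda>i. 0) \<in> nc_ball"
  by (rule row_bound_nc_ball[of _ 0]) (simp_all add: BH_def row_bound_def)

lemma has_free_series_at_zero: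
  assumes "has_free_series f a"
  shows "f (\<lambda>i. 0) = scale_op (a []) id_blinfun"
proof -
  have "homog_part (\<lambda>i. 0) k a = 0" if "k \<notin> {0}" for k
    using that by (cases k) (simp_all add: homog_part_Suc BH_def)
  then have "(\<lambda>k. homog_part (\<lambda>i. 0) k a) sums (\<Sum>k\<in>{0}. homog_part (\<lambda>i. 0) k a)"
    by (intro sums_finite) auto
  from sums_unique2[OF has_free_series_sums[OF assms nc_ball_zero] this] show ?thesis
    by (simp add: homog_part_0)
qed

context infinite_dimensional
begin

lemma orthonormal_words_exist:
  assumes "0 \<le> r" "r < 1"
  shows "\<exists>e :: 'n::finite list \<Rightarrow> 'h. orthonormal_words e M r"
  using orthonormal_family[OF finite_length_le[of "Suc M", where 'n = 'n]] assms
  by (auto simp: orthonormal_words_def)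

lemma has_free_series_unique:
  fixes f :: "('n::finite, 'h) ncfun"
  assumes "has_free_series f a" "has_free_series f b"
  shows "a = b"
proof
  fix \<gamma> :: "'n list"
  \<comment> \<open>Applying the value at these shifts to \<open>e []\<close> exhibits the
    coefficient at \<gamma>, scaled by a nonzero power of 1/2.\<close>
  obtain e :: "'n list \<Rightarrow> 'h" where "orthonormal_words e (length \<gamma>) (1/2)"
    using orthonormal_words_exist[of "1/2"] by auto
  then interpret orthonormal_words e "length \<gamma>" "1/2" .
  have "synth (\<lambda>\<alpha>. a \<alpha> * of_real (1/2) ^ length \<alpha>) = synth (\<lambda>\<alpha>. b \<alpha> * of_real (1/2) ^ length \<alpha>)"
    using has_free_series_wshift[OF assms(1), of "monomial []"]
      has_free_series_wshift[OF assms(2), of "monomial []"]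
    by (simp only: conv_monomial_Nil[abs_def])
  from arg_cong[OF this, of "\<lambda>x. cinner x (e \<gamma>)"] show "a \<gamma> = b \<gamma>"
    by (simp add: cinner_synth)
qed

lemma free_coeff_eq:
  fixes f :: "('n::finite, 'h) ncfun"
  assumes "has_free_series f a"
  shows "free_coeff f = a"
  unfolding free_coeff_def using has_free_series_unique[OF assms] assms by blast

text \<open>The values \<phi>_i at the shifts form a point of the ball, hence a contractive row;
  applied to the vectors \<open>synth (y i)\<close> it is the convolution in question, and
  \<open>norm_synth\<close> translates the norms.\<close>

lemma self_map_row_contraction_Suc:
  fixes \<phi> :: "'n::finite \<Rightarrow> ('n, 'h) ncfun"
  assumes "free_self_map \<phi>" and p: "\<And>i. has_free_series (\<phi> i) (p i)"
  shows "trunc_sq (Suc M) (\<lambda>\<gamma>. \<Sum>i\<in>UNIV. conv (p i) (y i) \<gamma>) \<le> (\<Sum>i\<in>UNIV. trunc_sq (Suc M) (y i))"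
proof -
  \<comment> \<open>Unweighted shifts need not lie in the open ball, so the weights approach 1 from
    below.\<close>
  define s where "s n = 1 - inverse (real (Suc n))" for n
  have s: "0 \<le> s n" "s n < 1" for n
    by (simp_all add: s_def field_simps)
  have le: "trunc_sq (Suc M) (\<lambda>\<gamma>. \<Sum>i\<in>UNIV. conv (\<lambda>\<alpha>. p i \<alpha> * of_real (s n) ^ length \<alpha>) (y i) \<gamma>)
      \<le> (\<Sum>i\<in>UNIV. trunc_sq (Suc M) (y i))" for n
  proof -
    obtain e :: "'n list \<Rightarrow> 'h" where "orthonormal_words e M (s n)"
      using orthonormal_words_exist[OF s] by blast
    then interpret orthonormal_words e M "s n" .
    have "(\<lambda>i. \<phi> i wshift) \<in> nc_ball"
      using assms(1) wshift_nc_ball by (simp add: free_self_map_def)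
    then obtain t where t: "t < 1" "row_bound t (\<lambda>i. \<phi> i wshift)"
      using nc_ball_row_bound by blast
    have "trunc_sq (Suc M) (\<lambda>\<gamma>. \<Sum>i\<in>UNIV. conv (\<lambda>\<alpha>. p i \<alpha> * of_real (s n) ^ length \<alpha>) (y i) \<gamma>)
        = (norm (\<Sum>i\<in>UNIV. \<phi> i wshift (synth (y i))))\<^sup>2"
      by (simp only: has_free_series_wshift[OF p] synth_sum[symmetric] norm_synth)
    also have "\<dots> \<le> t\<^sup>2 * (\<Sum>i\<in>UNIV. (norm (synth (y i)))\<^sup>2)"
      using t(2) by (simp add: row_bound_def)
    also have "\<dots> \<le> 1 * (\<Sum>i\<in>UNIV. (norm (synth (y i)))\<^sup>2)"
      using t by (intro mult_right_mono sum_nonneg) (auto simp: row_bound_def power_le_one)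
    finally show ?thesis
      by (simp add: norm_synth)
  qed
  have "s \<longlonglongrightarrow> 1 - 0"
    unfolding s_def by (intro tendsto_diff tendsto_const LIMSEQ_inverse_real_of_nat)
  then have "(\<lambda>n. p i \<alpha> * complex_of_real (s n) ^ length \<alpha>) \<longlonglongrightarrow> p i \<alpha> * complex_of_real (1 - 0) ^ length \<alpha>" for i \<alpha>
    by (intro tendsto_intros)
  then have "(\<lambda>n. conv (\<lambda>\<alpha>. p i \<alpha> * of_real (s n) ^ length \<alpha>) (y i) \<gamma>) \<longlonglongrightarrow> conv (p i) (y i) \<gamma>" for i \<gamma>
    by (intro conv_tendsto_left) simp
  then have "(\<lambda>n. trunc_sq (Suc M) (\<lambda>\<gamma>. \<Sum>i\<in>UNIV. conv (\<lambda>\<alpha>. p i \<alpha> * of_real (s n) ^ length \<alpha>) (y i) \<gamma>))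
      \<longlonglongrightarrow> trunc_sq (Suc M) (\<lambda>\<gamma>. \<Sum>i\<in>UNIV. conv (p i) (y i) \<gamma>)"
    unfolding trunc_sq_def by (intro tendsto_intros)
  then show ?thesis
    by (rule LIMSEQ_le_const2) (use le in blast)
qed

lemma formal_self_map_coeff:
  fixes \<phi> :: "'n::finite \<Rightarrow> ('n, 'h) ncfun"
  assumes "free_self_map \<phi>" and p: "\<And>i. has_free_series (\<phi> i) (p i)"
  shows "formal_self_map p"
proof
  fix N and y :: "'n \<Rightarrow> 'n list \<Rightarrow> complex"
  show "trunc_sq N (\<lambda>\<gamma>. \<Sum>i\<in>UNIV. conv (p i) (y i) \<gamma>) \<le> (\<Sum>i\<in>UNIV. trunc_sq N (y i))"
  proof (cases N)
    case 0
    \<comment> \<open>The shift model reaches levels \<open>Suc M\<close> only. Cutting each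
      \<open>y i\<close> down to its constant term keeps the constant coefficient of the product and
      adds nothing to the right side at level 1.\<close>
    have "trunc_sq 0 (\<lambda>\<gamma>. \<Sum>i\<in>UNIV. conv (p i) (y i) \<gamma>)
        = trunc_sq 0 (\<lambda>\<gamma>. \<Sum>i\<in>UNIV. conv (p i) (trunc 0 (y i)) \<gamma>)"
      by (simp add: trunc_def)
    also have "\<dots> \<le> trunc_sq (Suc 0) (\<lambda>\<gamma>. \<Sum>i\<in>UNIV. conv (p i) (trunc 0 (y i)) \<gamma>)"
      by (rule trunc_sq_mono) simp
    also have "\<dots> \<le> (\<Sum>i\<in>UNIV. trunc_sq (Suc 0) (trunc 0 (y i)))"
      by (rule self_map_row_contraction_Suc[OF assms])
    also have "\<dots> = (\<Sum>i\<in>UNIV. trunc_sq 0 (y i))"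
      by (simp add: trunc_sq_Suc trunc_def)
    finally show ?thesis
      using 0 by simp
  qed (simp add: self_map_row_contraction_Suc[OF assms])
next
  define L where "L = (\<Sum>i\<in>UNIV. (cmod (p i []))\<^sup>2)"
  have L0: "0 \<le> L"
    by (simp add: L_def sum_nonneg)
  obtain e :: "'n list \<Rightarrow> 'h" where "orthonormal_words e 0 0"
    using orthonormal_words_exist[of 0] by auto
  then have "cinner (e []) (e []) = 1"
    by (simp add: orthonormal_words_def)
  then have e: "(norm (e []))\<^sup>2 = 1"
    by (simp add: cinner_self flip: of_real_power)
  have "(\<lambda>i. \<phi> i (\<lambda>i. 0)) \<in> nc_ball"
    using assms(1) nc_ball_zero unfolding free_self_map_def by blast
  then obtain t where t: "t < 1" "row_bound t (\<lambda>i. \<phi> i (\<lambda>i. 0))"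
    using nc_ball_row_bound by blast
  \<comment> \<open>The contraction alone would give only \<open>L \<le> 1\<close>. The value of
    \<phi> at 0 is a row of norm at most \<open>t < 1\<close>, and these test vectors give
    \<open>L * L \<le> t\<^sup>2 * L\<close>.\<close>
  have "(\<Sum>i\<in>UNIV. \<phi> i (\<lambda>i. 0) (cnj (p i []) *\<^sub>C e [])) = of_real L *\<^sub>C e []"
    by (simp add: has_free_series_at_zero[OF p] scaleC_scaleC L_def complex_norm_square
        scaleC_sum_left[symmetric] del: of_real_power)
  then have "(norm (complex_of_real L *\<^sub>C e []))\<^sup>2 \<le> t\<^sup>2 * (\<Sum>i\<in>UNIV. (norm (cnj (p i []) *\<^sub>C e []))\<^sup>2)"
    using t(2) unfolding row_bound_def by metis
  then have "L * L \<le> t\<^sup>2 * L"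
    by (simp add: norm_scaleC power_mult_distrib e L_def[symmetric]) (simp add: power2_eq_square)
  moreover have "t\<^sup>2 < 1"
    using t by (simp add: row_bound_def power_less_one_iff)
  ultimately show "(\<Sum>i\<in>UNIV. (cmod (p i []))\<^sup>2) < 1"
    unfolding L_def[symmetric] using L0 by (cases "L = 0") auto
qed

end

section \<open>The composition operator and its adjoint\<close>

context infinite_dimensional
begin

lemma free_coeff_free_eval: "ell2 a \<Longrightarrow> free_coeff (free_eval a :: ('n::finite, 'h) ncfun) = a"
  by (rule free_coeff_eq[OF has_free_series_free_eval])

lemma free_eval_in_H2: "ell2 a \<Longrightarrow> (free_eval a :: ('n::finite, 'h) ncfun) \<in> H2_ball"
  using has_free_series_free_eval[of a]
  by (auto simp: H2_ball_def free_holomorphic_def free_coeff_free_eval ell2_def[symmetric])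

lemma free_holomorphic_coeff:
  fixes f :: "('n::finite, 'h) ncfun"
  shows "free_holomorphic f \<Longrightarrow> has_free_series f (free_coeff f)"
  using free_coeff_eq unfolding free_holomorphic_def by blast

lemma H2_ball_D:
  fixes f :: "('n::finite, 'h) ncfun"
  assumes "f \<in> H2_ball"
  shows "ell2 (free_coeff f)" "f = free_eval (free_coeff f)"
  using assms free_holomorphic_coeff[of f] has_free_series_eq_free_eval
  by (auto simp: H2_ball_def ell2_def)

lemma H2_inner_ell2: "H2_inner f g = ell2_inner (free_coeff f) (free_coeff g)"
  by (simp add: H2_inner_def ell2_inner_def)

lemma H2_norm_ell2: "H2_norm f = sqrt (ell2_sq (free_coeff f))"
  by (simp add: H2_norm_def H2_inner_ell2 ell2_inner_self)

lemma H2_add: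
  fixes f g :: "('n::finite, 'h) ncfun"
  assumes "f \<in> H2_ball" "g \<in> H2_ball"
  shows "(\<lambda>X\<in>nc_ball. f X + g X) = free_eval (\<lambda>\<alpha>. free_coeff f \<alpha> + free_coeff g \<alpha>)"
proof (rule extensionalityI[of _ nc_ball])
  show "(\<lambda>X\<in>nc_ball. f X + g X) X = free_eval (\<lambda>\<alpha>. free_coeff f \<alpha> + free_coeff g \<alpha>) X"
    if "X \<in> nc_ball" for X
    using that H2_ball_D(2)[OF assms(1)] H2_ball_D(2)[OF assms(2)]
    by (simp add: free_eval_add[OF that H2_ball_D(1)[OF assms(1)] H2_ball_D(1)[OF assms(2)]])
qed (simp_all add: free_eval_def)

lemma H2_scale:
  fixes f :: "('n::finite, 'h) ncfun"
  assumes "f \<in> H2_ball"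
  shows "(\<lambda>X\<in>nc_ball. scale_op c (f X)) = free_eval (\<lambda>\<alpha>. c * free_coeff f \<alpha>)"
proof (rule extensionalityI[of _ nc_ball])
  show "(\<lambda>X\<in>nc_ball. scale_op c (f X)) X = free_eval (\<lambda>\<alpha>. c * free_coeff f \<alpha>) X"
    if "X \<in> nc_ball" for X
    using that H2_ball_D(2)[OF assms] by (simp add: free_eval_scale[OF that H2_ball_D(1)[OF assms]])
qed (simp_all add: free_eval_def)

text \<open>Testing against the monomials determines the adjoint.\<close>

lemma H2_adjoint_eqI:
  fixes T S :: "('n::finite, 'h) ncfun \<Rightarrow> ('n, 'h) ncfun"
  assumes "is_H2_adjoint T S"
  shows "H2_adjoint T = S"
  unfolding H2_adjoint_def
proof (rule the_equality)
  fix R assume R: "is_H2_adjoint T R"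
  show "R = S"
  proof (rule extensionalityI[of _ H2_ball])
    fix g :: "('n, 'h) ncfun" assume g: "g \<in> H2_ball"
    have RS: "R g \<in> H2_ball" "S g \<in> H2_ball"
      using R assms g by (auto simp: is_H2_adjoint_def H2_bounded_operator_def)
    have "free_coeff (R g) \<alpha> = free_coeff (S g) \<alpha>" for \<alpha>
    proof -
      define m :: "('n, 'h) ncfun" where "m = free_eval (monomial \<alpha>)"
      have "m \<in> H2_ball"
        unfolding m_def by (rule free_eval_in_H2[OF ell2_monomial])
      then have "H2_inner m (R g) = H2_inner m (S g)"
        using R assms g unfolding is_H2_adjoint_def by metis
      then show ?thesis
        by (simp add: H2_inner_ell2 m_def free_coeff_free_eval ell2_monomial ell2_inner_monomial_left)
    qed
    then show "R g = S g"
      using H2_ball_D(2)[OF RS(1)] H2_ball_D(2)[OF RS(2)] by (metis ext)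
  qed (use R assms in \<open>auto simp: is_H2_adjoint_def\<close>)
qed (rule assms)

end

locale composition_operator = infinite_dimensional H for H :: "'h::chilbert_space itself" +
  fixes \<phi> :: "'n::finite \<Rightarrow> ('n, 'h::chilbert_space) ncfun"
  assumes self_map: "free_self_map \<phi>"
begin

lemma has_free_series_component: "has_free_series (\<phi> i) (free_coeff (\<phi> i))"
  using self_map free_holomorphic_coeff unfolding free_self_map_def by blast

sublocale formal_self_map "\<lambda>i. free_coeff (\<phi> i)"
  by (rule formal_self_map_coeff[OF self_map has_free_series_component])

lemma image_nc_ball: "X \<in> nc_ball \<Longrightarrow> (\<lambda>i. \<phi> i X) \<in> nc_ball"
  using self_map by (simp add: free_self_map_def)

abbreviation comp_poly :: "nat \<Rightarrow> ('n list \<Rightarrow> complex) \<Rightarrow> 'n list \<Rightarrow> complex" where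
  "comp_poly \<equiv> comp_coeff (\<lambda>i. free_coeff (\<phi> i))"

text \<open>The bridge from formal composition to operators: evaluation turns \<open>conv\<close>
  into operator products, so the recursion of \<open>comp_coeff\<close> becomes
  \<open>homog_part_Suc\<close> at the point \<phi>(X).\<close>

lemma free_eval_comp_poly:
  assumes X: "X \<in> nc_ball"
  shows "free_eval (comp_poly d a) X = (\<Sum>k\<le>d. homog_part (\<lambda>i. \<phi> i X) k a)"
proof (induction d arbitrary: a)
  case 0
  show ?case
    by (simp add: free_eval_constant[OF X] homog_part_0)
next
  case (Suc d)
  interpret comp: bounded_bilinear "(o\<^sub>L) :: ('h \<Rightarrow>\<^sub>L 'h) \<Rightarrow> ('h \<Rightarrow>\<^sub>L 'h) \<Rightarrow> ('h \<Rightarrow>\<^sub>L 'h)"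
    by (rule bounded_bilinear_blinfun_compose)
  have \<phi>: "free_eval (free_coeff (\<phi> i)) X = \<phi> i X" for i
    using has_free_series_eq_free_eval[OF has_free_series_component] by metis
  have "free_eval (comp_poly (Suc d) a) X = scale_op (a []) id_blinfun
      + (\<Sum>i\<in>UNIV. \<phi> i X o\<^sub>L (\<Sum>k\<le>d. homog_part (\<lambda>i. \<phi> i X) k (\<lambda>\<alpha>. a (i # \<alpha>))))"
    by (simp add: free_eval_add[OF X] free_eval_sum[OF X] free_eval_constant[OF X]
        free_eval_conv[OF X] ell2_scale ell2_monomial ell2_sum ell2_conv ell2_comp_coeff ell2_p Suc \<phi>)
  also have "(\<Sum>i\<in>UNIV. \<phi> i X o\<^sub>L (\<Sum>k\<le>d. homog_part (\<lambda>i. \<phi> i X) k (\<lambda>\<alpha>. a (i # \<alpha>))))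
      = (\<Sum>k\<le>d. homog_part (\<lambda>i. \<phi> i X) (Suc k) a)"
    unfolding homog_part_Suc[OF nc_ball_BH[OF image_nc_ball[OF X]]] comp.sum_right by (rule sum.swap)
  finally show ?case
    by (simp add: sum.atMost_Suc_shift homog_part_0 del: sum.atMost_Suc)
qed

text \<open>The formal composites converge in the norm of coefficients, and evaluation at
  \<open>X\<close> is continuous in that norm.\<close>

lemma free_eval_comp_limit:
  assumes X: "X \<in> nc_ball" and a: "ell2 a"
  shows "(\<lambda>k. homog_part (\<lambda>i. \<phi> i X) k a) sums free_eval (comp_limit a) X"
proof -
  obtain C where C: "0 \<le> C" "\<And>a. ell2 a \<Longrightarrow> norm (free_eval a X) \<le> C * sqrt (ell2_sq a)"
    using free_eval_bound[OF X] by blast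
  have "(\<lambda>d. free_eval (comp_limit a) X - free_eval (comp_poly d a) X) \<longlonglongrightarrow> 0"
  proof (rule Lim_null_comparison)
    have "norm (free_eval (comp_limit a) X - free_eval (comp_poly d a) X) \<le> C * tail_bound a d" for d
    proof -
      define h where "h \<gamma> = comp_limit a \<gamma> - comp_poly d a \<gamma>" for \<gamma>
      have h: "ell2 h" "sqrt (ell2_sq h) \<le> tail_bound a d"
        unfolding h_def[abs_def] by (rule comp_limit_tail[OF a])+
      have "free_eval (comp_limit a) X - free_eval (comp_poly d a) X = free_eval h X"
        unfolding h_def[abs_def]
        by (rule free_eval_diff[OF X comp_limit_bound(1)[OF a] ell2_comp_coeff, symmetric])
      then show ?thesis
        using C(2)[OF h(1)] mult_left_mono[OF h(2) C(1)] by simp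
    qed
    then show "\<forall>\<^sub>F d in sequentially. norm (free_eval (comp_limit a) X - free_eval (comp_poly d a) X)
        \<le> C * tail_bound a d"
      by (intro always_eventually allI)
    show "(\<lambda>d. C * tail_bound a d) \<longlonglongrightarrow> 0"
      by (rule tendsto_mult_right_zero[OF tail_bound_tendsto[OF a]])
  qed
  then have "(\<lambda>d. free_eval (comp_poly d a) X) \<longlonglongrightarrow> free_eval (comp_limit a) X"
    using tendsto_diff[OF tendsto_const[of "free_eval (comp_limit a) X"]] by fastforce
  then show ?thesis
    by (simp add: sums_def_le free_eval_comp_poly[OF X])
qed

lemma free_eval_comp_limit_eq:
  assumes "X \<in> nc_ball" "f \<in> H2_ball"
  shows "free_eval (comp_limit (free_coeff f)) X = f (\<lambda>i. \<phi> i X)"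
proof -
  have "(\<lambda>k. homog_part (\<lambda>i. \<phi> i X) k (free_coeff f)) sums free_eval (free_coeff f) (\<lambda>i. \<phi> i X)"
    by (rule free_eval_sums[OF image_nc_ball[OF assms(1)] H2_ball_D(1)[OF assms(2)]])
  from sums_unique2[OF free_eval_comp_limit[OF assms(1) H2_ball_D(1)[OF assms(2)]] this]
  show ?thesis
    using H2_ball_D(2)[OF assms(2)] by metis
qed

lemma map_word_eq_free_eval: "map_word \<phi> \<alpha> = free_eval (comp_limit (monomial \<alpha>))"
proof (rule extensionalityI[of _ nc_ball])
  fix X :: "'n \<Rightarrow> 'h \<Rightarrow>\<^sub>L 'h" assume X: "X \<in> nc_ball"
  define Y where "Y i = \<phi> i X" for i
  have hom: "homog_part Y k (monomial \<alpha>) = (if k = length \<alpha> then word_op Y \<alpha> else 0)" for k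
  proof (rule blinfun_eqI)
    fix x
    have "(\<Sum>\<beta> | length \<beta> = k. monomial \<alpha> \<beta> *\<^sub>C word_op Y \<beta> x)
        = (\<Sum>\<beta> | length \<beta> = k. if \<beta> = \<alpha> then word_op Y \<beta> x else 0)"
      by (rule sum.cong) (auto simp: monomial_def)
    then show "homog_part Y k (monomial \<alpha>) x = (if k = length \<alpha> then word_op Y \<alpha> else 0) x"
      by (auto simp: homog_part_apply)
  qed
  have "free_eval (comp_limit (monomial \<alpha>)) X = (\<Sum>k\<le>length \<alpha>. homog_part Y k (monomial \<alpha>))"
    unfolding comp_limit_monomial free_eval_comp_poly[OF X] Y_def[abs_def] ..
  then show "map_word \<phi> \<alpha> X = free_eval (comp_limit (monomial \<alpha>)) X"
    using X unfolding hom by (simp add: map_word_def Y_def[abs_def])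
qed (simp_all add: map_word_def free_eval_def)

lemma free_coeff_map_word: "free_coeff (map_word \<phi> \<alpha>) = comp_limit (monomial \<alpha>)"
  unfolding map_word_eq_free_eval by (rule free_coeff_free_eval[OF comp_limit_bound(1)[OF ell2_monomial]])

lemma comp_op_eq_free_eval:
  assumes f: "f \<in> H2_ball"
  shows "comp_op \<phi> f = free_eval (comp_limit (free_coeff f))"
proof (rule extensionalityI[of _ nc_ball])
  fix X :: "'n \<Rightarrow> 'h \<Rightarrow>\<^sub>L 'h" assume X: "X \<in> nc_ball"
  have "comp_op \<phi> f X = (\<Sum>k. homog_part (\<lambda>i. \<phi> i X) k (free_coeff f))"
    using X by (simp add: comp_op_def map_word_def homog_part_def)
  then show "comp_op \<phi> f X = free_eval (comp_limit (free_coeff f)) X"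
    using sums_unique[OF free_eval_comp_limit[OF X H2_ball_D(1)[OF f]]] by simp
qed (simp_all add: comp_op_def free_eval_def)

text \<open>Reduces the linearity of the composition operator to pointwise identities.\<close>

lemma comp_op_apply:
  "f \<in> H2_ball \<Longrightarrow> X \<in> nc_ball \<Longrightarrow> comp_op \<phi> f X = f (\<lambda>i. \<phi> i X)"
  by (simp add: comp_op_eq_free_eval free_eval_comp_limit_eq)

lemma comp_op_in_H2: "f \<in> H2_ball \<Longrightarrow> comp_op \<phi> f \<in> H2_ball"
  by (simp add: comp_op_eq_free_eval free_eval_in_H2 comp_limit_bound H2_ball_D)

lemma free_coeff_comp_op: "f \<in> H2_ball \<Longrightarrow> free_coeff (comp_op \<phi> f) = comp_limit (free_coeff f)"
  by (simp add: comp_op_eq_free_eval free_coeff_free_eval comp_limit_bound H2_ball_D)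

lemma comp_op_extensional: "comp_op \<phi> f \<in> extensional nc_ball"
  by (simp add: comp_op_def)

section \<open>Boundedness and identification of the adjoint\<close>

lemma bounded_comp_op: "H2_bounded_operator (comp_op \<phi>)"
  unfolding H2_bounded_operator_def
proof (intro conjI ballI allI)
  fix f g :: "('n, 'h) ncfun" and c :: complex
  assume f: "f \<in> H2_ball" and g: "g \<in> H2_ball"
  have "(\<lambda>X\<in>nc_ball. f X + g X) \<in> H2_ball"
    using f g by (simp add: H2_add free_eval_in_H2 ell2_add H2_ball_D)
  then show "comp_op \<phi> (\<lambda>X\<in>nc_ball. f X + g X) = (\<lambda>X\<in>nc_ball. comp_op \<phi> f X + comp_op \<phi> g X)"
    using f g
    by (intro extensionalityI[of _ nc_ball]) (simp_all add: comp_op_extensional comp_op_apply image_nc_ball)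
next
  fix f :: "('n, 'h) ncfun" and c :: complex
  assume f: "f \<in> H2_ball"
  have "(\<lambda>X\<in>nc_ball. scale_op c (f X)) \<in> H2_ball"
    using f by (simp add: H2_scale free_eval_in_H2 ell2_scale H2_ball_D)
  then show "comp_op \<phi> (\<lambda>X\<in>nc_ball. scale_op c (f X)) = (\<lambda>X\<in>nc_ball. scale_op c (comp_op \<phi> f X))"
    using f
    by (intro extensionalityI[of _ nc_ball]) (simp_all add: comp_op_extensional comp_op_apply image_nc_ball)
next
  have "H2_norm (comp_op \<phi> f) \<le> 1 / (1 - r0) * H2_norm f" if "f \<in> H2_ball" for f :: "('n, 'h) ncfun"
    using real_sqrt_le_mono[OF comp_limit_bound(2)[OF H2_ball_D(1)[OF that]]] r0(2)
    by (simp add: H2_norm_ell2 free_coeff_comp_op[OF that])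
  then show "\<exists>K. \<forall>f\<in>H2_ball. H2_norm (comp_op \<phi> f) \<le> K * H2_norm f"
    by blast
qed (rule comp_op_in_H2)

text \<open>The restriction provides the extensionality that \<open>is_H2_adjoint\<close>
  demands.\<close>

definition adj_op :: "('n, 'h) ncfun \<Rightarrow> ('n, 'h) ncfun" where
  "adj_op = (\<lambda>f\<in>H2_ball. free_eval (comp_adjoint (free_coeff f)))"

lemma adj_op_in_H2: "f \<in> H2_ball \<Longrightarrow> adj_op f \<in> H2_ball"
  by (simp add: adj_op_def free_eval_in_H2 comp_adjoint_bound H2_ball_D)

lemma free_coeff_adj_op: "f \<in> H2_ball \<Longrightarrow> free_coeff (adj_op f) = comp_adjoint (free_coeff f)"
  by (simp add: adj_op_def free_coeff_free_eval comp_adjoint_bound H2_ball_D)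

lemma adj_op_eqI:
  assumes "h \<in> H2_ball" "ell2 u" "\<And>\<alpha>. comp_adjoint (free_coeff h) \<alpha> = u \<alpha>"
  shows "adj_op h = free_eval u"
proof -
  have "comp_adjoint (free_coeff h) = u"
    using assms(3) by blast
  then show ?thesis
    using assms(1) by (simp add: adj_op_def)
qed

lemma bounded_adj_op: "H2_bounded_operator adj_op"
  unfolding H2_bounded_operator_def
proof (intro conjI ballI allI)
  fix f g :: "('n, 'h) ncfun"
  assume f: "f \<in> H2_ball" and g: "g \<in> H2_ball"
  have e: "ell2 (free_coeff f)" "ell2 (free_coeff g)"
    using f g by (simp_all add: H2_ball_D)
  have "adj_op (\<lambda>X\<in>nc_ball. f X + g X)
      = free_eval (\<lambda>\<alpha>. free_coeff (adj_op f) \<alpha> + free_coeff (adj_op g) \<alpha>)"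
    unfolding H2_add[OF f g] free_coeff_adj_op[OF f] free_coeff_adj_op[OF g]
  proof (rule adj_op_eqI)
    show "comp_adjoint (free_coeff (free_eval (\<lambda>\<alpha>. free_coeff f \<alpha> + free_coeff g \<alpha>) :: ('n, 'h) ncfun)) \<alpha>
        = comp_adjoint (free_coeff f) \<alpha> + comp_adjoint (free_coeff g) \<alpha>" for \<alpha>
      by (simp add: free_coeff_free_eval ell2_add e comp_adjoint_def ell2_inner_add_left
          comp_limit_bound ell2_monomial)
  qed (simp_all add: e free_eval_in_H2 ell2_add comp_adjoint_bound)
  then show "adj_op (\<lambda>X\<in>nc_ball. f X + g X) = (\<lambda>X\<in>nc_ball. adj_op f X + adj_op g X)"
    by (simp add: H2_add adj_op_in_H2 f g)
next
  fix f :: "('n, 'h) ncfun" and c :: complex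
  assume f: "f \<in> H2_ball"
  have e: "ell2 (free_coeff f)"
    using f by (simp add: H2_ball_D)
  have "adj_op (\<lambda>X\<in>nc_ball. scale_op c (f X)) = free_eval (\<lambda>\<alpha>. c * free_coeff (adj_op f) \<alpha>)"
    unfolding H2_scale[OF f] free_coeff_adj_op[OF f]
  proof (rule adj_op_eqI)
    show "comp_adjoint (free_coeff (free_eval (\<lambda>\<alpha>. c * free_coeff f \<alpha>) :: ('n, 'h) ncfun)) \<alpha>
        = c * comp_adjoint (free_coeff f) \<alpha>" for \<alpha>
      by (simp add: free_coeff_free_eval ell2_scale e comp_adjoint_def ell2_inner_scale_left
          comp_limit_bound ell2_monomial)
  qed (simp_all add: e free_eval_in_H2 ell2_scale comp_adjoint_bound)
  then show "adj_op (\<lambda>X\<in>nc_ball. scale_op c (f X)) = (\<lambda>X\<in>nc_ball. scale_op c (adj_op f X))"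
    by (simp add: H2_scale adj_op_in_H2 f)
next
  have "H2_norm (adj_op f) \<le> 1 / (1 - r0) * H2_norm f" if "f \<in> H2_ball" for f :: "('n, 'h) ncfun"
    using real_sqrt_le_mono[OF comp_adjoint_bound(2)[OF H2_ball_D(1)[OF that]]] r0(2)
    by (simp add: H2_norm_ell2 free_coeff_adj_op[OF that])
  then show "\<exists>K. \<forall>f\<in>H2_ball. H2_norm (adj_op f) \<le> K * H2_norm f"
    by blast
qed (rule adj_op_in_H2)

lemma H2_adjoint_comp_op: "H2_adjoint (comp_op \<phi>) = adj_op"
proof (rule H2_adjoint_eqI)
  show "is_H2_adjoint (comp_op \<phi>) adj_op"
    unfolding is_H2_adjoint_def
  proof (intro conjI ballI bounded_comp_op bounded_adj_op)
    show "adj_op \<in> extensional H2_ball"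
      by (simp add: adj_op_def)
    show "H2_inner (comp_op \<phi> f) g = H2_inner f (adj_op g)" if "f \<in> H2_ball" "g \<in> H2_ball" for f g
      using that by (simp add: H2_inner_ell2 free_coeff_comp_op free_coeff_adj_op ell2_inner_comp_limit H2_ball_D)
  qed
qed

end

theorem proposition4p1:
  fixes \<phi> :: "'n::finite \<Rightarrow> ('n, 'h::chilbert_space) ncfun"
  assumes separable: "\<exists>D::'h set. countable D \<and> closure D = UNIV"
    and infinite_dim: "\<nexists>B::'h set. finite B \<and> module.span scaleC B = UNIV"
    and self_map: "free_self_map \<phi>"
  shows "\<forall>f\<in>H2_ball. \<forall>X\<in>nc_ball.
    (\<lambda>k. \<Sum>\<alpha> | length \<alpha> = k. scale_op (H2_inner f (map_word \<phi> \<alpha>)) (word_op X \<alpha>))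
      sums H2_adjoint (comp_op \<phi>) f X"
proof (intro ballI)
  fix f :: "('n, 'h) ncfun" and X :: "'n \<Rightarrow> 'h \<Rightarrow>\<^sub>L 'h"
  assume f: "f \<in> H2_ball" and X: "X \<in> nc_ball"
  interpret composition_operator "TYPE('h)" \<phi>
    by unfold_locales (use infinite_dim self_map in auto)
  \<comment> \<open>The duality bound makes the coefficients square summable, hence the series norm
    convergent at \<open>X\<close>.\<close>
  have "(\<lambda>k. homog_part X k (comp_adjoint (free_coeff f))) sums free_eval (comp_adjoint (free_coeff f)) X"
    by (intro free_eval_sums X comp_adjoint_bound H2_ball_D f)
  then show "(\<lambda>k. \<Sum>\<alpha> | length \<alpha> = k. scale_op (H2_inner f (map_word \<phi> \<alpha>)) (word_op X \<alpha>))
      sums H2_adjoint (comp_op \<phi>) f X"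
    using f by (simp add: H2_adjoint_comp_op adj_op_def homog_part_def comp_adjoint_def
        H2_inner_ell2 free_coeff_map_word)
qed

end
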